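(* Let $X$ be a locally compact Hausdorff space. (1) Consider the statements: (a) the proper simple deficient topological measures that are not topological measures are dense in the set of all point-masses; (b) $p\mathbf{DTM}(X)\setminus\mathbf{TM}(X)$ is dense in $\mathbf{M}(X)$; (c) $p\mathbf{DTM}(X)\setminus\mathbf{TM}(X)$ is dense in $\mathbf{DTM}(X)\setminus\mathbf{TM}(X)$; (d) $p\mathbf{DTM}(X)$ is dense in $\mathbf{DTM}(X)$; (e) $p\mathbf{DTM}(X)$ is dense in $\mathbf{M}(X)$. Then (a) $\Rightarrow$ (b) $\Leftrightarrow$ (c) $\Rightarrow$ (d) $\Leftrightarrow$ (e). (2) Consider the statements: (a') the proper simple finite topological measures are dense in the set of all point-masses; (b') $p\mathbf{TM}(X)$ is dense in $\mathbf{M}(X)$; (c') $p\mathbf{TM}(X)$ is dense in $\mathbf{TM}(X)$; (d') $p\mathbf{DTM}(X)$ is dense in $\mathbf{DTM}(X)$. Then (a') $\Rightarrow$ (b') $\Leftrightarrow$ (c') $\Rightarrow$ (d').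
   Context: $\mathcal{O}(X)$, $\mathcal{C}(X)$, $\mathcal{K}(X)$ are the collections of open, closed, compact subsets of $X$. A deficient topological measure on $X$ is a set function $\nu:\mathcal{C}(X)\cup\mathcal{O}(X)\to[0,\infty]$, not identically $\infty$, such that: (DTM1) $\nu(C\sqcup K)=\nu(C)+\nu(K)$ for disjoint $C,K\in\mathcal{K}(X)$; (DTM2) $\nu(U)=\sup\{\nu(C): C\subseteq U,\ C\in\mathcal{K}(X)\}$ for $U\in\mathcal{O}(X)$; (DTM3) $\nu(F)=\inf\{\nu(U): F\subseteq U,\ U\in\mathcal{O}(X)\}$ for $F\in\mathcal{C}(X)$. A topological measure is a set function $\mu:\mathcal{C}(X)\cup\mathcal{O}(X)\to[0,\infty]$, not identically $\infty$, satisfying (DTM2), (DTM3) and: if $A,B,A\sqcup B\in\mathcal{K}(X)\cup\mathcal{O}(X)$ (disjoint union) then $\mu(A\sqcup B)=\mu(A)+\mu(B)$. $\mathbf{DTM}(X)$, $\mathbf{TM}(X)$ are the sets of finite ($\mu(X)<\infty$) deficient topological measures and finite topological measures. $\mathbf{M}(X)$ is the set of restrictions to $\mathcal{O}(X)\cup\mathcal{C}(X)$ of finite Borel measures on $X$ that are inner regular (by compact sets) on open sets and outer regular (by open sets) on all Borel sets. One has $\mathbf{M}(X)\subseteq\mathbf{TM}(X)\subseteq\mathbf{DTM}(X)$. A set function is simple if it only assumes values $0$ and $1$. The point-mass $\delta_a$ at $a\in X$ is $\delta_a(A)=1$ if $a\in A$ and $0$ otherwise. A deficient topological measure $\nu$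 is proper if $m\le\nu$ (on $\mathcal{O}(X)\cup\mathcal{C}(X)$) with $m$ a Radon measure implies $m=0$; here a Radon measure is a Borel measure finite on compact sets, outer regular on all Borel sets and inner regular (by compact sets) on open sets. $p\mathbf{DTM}(X)$ and $p\mathbf{TM}(X)$ are the sets of proper elements of $\mathbf{DTM}(X)$ and $\mathbf{TM}(X)$. $\mathbf{DTM}(X)$ carries the weak topology: the coarsest topology making $\mu\mapsto\int_X f\,d\mu$ continuous for every $f\in C_0^+(X)$ (nonnegative continuous functions vanishing at infinity), where $\int_X f\,d\mu=\int_0^b\mu(f^{-1}((t,\infty)))\,dt$ if $f(X)\subseteq[0,b]$. "$Y$ is dense in $Z$" means $Z\subseteq\overline{Y}$ (closure in $\mathbf{DTM}(X)$).
   Formalization: X is taken nonempty, and (c)⇒(b) and (c)⇒(d) are stated under the assumption that DTM(X)∖TM(X) is nonempty; otherwise, e.g. for a one-point X, (c) holds vacuously while (b) and (d) fail. All other implications are as stated. *)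

theory Defs
  imports "HOL-Analysis.Analysis"
begin

(* The space X is the universe of a type of class topological_space (t2_space for Hausdorff).
   Set functions live on the open and the closed sets only: they are kept extensional outside
   that family, so that equality of set functions is equality on the open and the closed sets. *)

definition open_closed_sets :: "'a::topological_space set set" where
  "open_closed_sets = {A. open A \<or> closed A}"

definition not_identically_infinite :: "('a::topological_space set \<Rightarrow> ennreal) \<Rightarrow> bool" where
  "not_identically_infinite \<nu> \<longleftrightarrow> (\<exists>A\<in>open_closed_sets. \<nu> A \<noteq> \<infinity>)"

definition inner_compact_on_open :: "('a::topological_space set \<Rightarrow> ennreal) \<Rightarrow> bool" where
  "inner_compact_on_open \<nu> \<longleftrightarrow> (\<forall>U. open U \<longrightarrow> \<nu> U = (SUP C\<in>{C. compact C \<and> C \<subseteq> U}. \<nu> C))"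

definition outer_open_on :: "'a::topological_space set set \<Rightarrow> ('a set \<Rightarrow> ennreal) \<Rightarrow> bool" where
  "outer_open_on \<A> \<nu> \<longleftrightarrow> (\<forall>A\<in>\<A>. \<nu> A = (INF U\<in>{U. open U \<and> A \<subseteq> U}. \<nu> U))"

definition deficient_topological_measure :: "('a::t2_space set \<Rightarrow> ennreal) \<Rightarrow> bool" where
  "deficient_topological_measure \<nu> \<longleftrightarrow>
     \<nu> \<in> extensional open_closed_sets \<and>
     not_identically_infinite \<nu> \<and>
     (\<forall>C K. compact C \<and> compact K \<and> C \<inter> K = {} \<longrightarrow> \<nu> (C \<union> K) = \<nu> C + \<nu> K) \<and>
     inner_compact_on_open \<nu> \<and>
     outer_open_on {F. closed F} \<nu>"

definition topological_measure :: "('a::t2_space set \<Rightarrow> ennreal) \<Rightarrow> bool" where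
  "topological_measure \<mu> \<longleftrightarrow>
     \<mu> \<in> extensional open_closed_sets \<and>
     not_identically_infinite \<mu> \<and>
     (\<forall>A B. (compact A \<or> open A) \<and> (compact B \<or> open B) \<and> (compact (A \<union> B) \<or> open (A \<union> B)) \<and>
        A \<inter> B = {} \<longrightarrow> \<mu> (A \<union> B) = \<mu> A + \<mu> B) \<and>
     inner_compact_on_open \<mu> \<and>
     outer_open_on {F. closed F} \<mu>"

definition DTM :: "('a::t2_space set \<Rightarrow> ennreal) set" where
  "DTM = {\<nu>. deficient_topological_measure \<nu> \<and> \<nu> UNIV < \<infinity>}"

definition TM :: "('a::t2_space set \<Rightarrow> ennreal) set" where
  "TM = {\<mu>. topological_measure \<mu> \<and> \<mu> UNIV < \<infinity>}"

definition regular_borel_measure :: "'a::t2_space measure \<Rightarrow> bool" where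
  "regular_borel_measure m \<longleftrightarrow>
     sets m = sets borel \<and>
     inner_compact_on_open (emeasure m) \<and>
     outer_open_on (sets borel) (emeasure m)"

definition radon_measure :: "'a::t2_space measure \<Rightarrow> bool" where
  "radon_measure m \<longleftrightarrow>
     regular_borel_measure m \<and> (\<forall>K. compact K \<longrightarrow> emeasure m K < \<infinity>)"

(* The set usually written bold M(X). *)
definition FBM :: "('a::t2_space set \<Rightarrow> ennreal) set" where
  "FBM = {restrict (emeasure m) open_closed_sets | m. finite_measure m \<and> regular_borel_measure m}"

definition simple_set_function :: "('a::t2_space set \<Rightarrow> ennreal) \<Rightarrow> bool" where
  "simple_set_function \<nu> \<longleftrightarrow> (\<forall>A\<in>open_closed_sets. \<nu> A \<in> {0, 1})"

definition point_mass :: "'a::t2_space \<Rightarrow> 'a set \<Rightarrow> ennreal" where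
  "point_mass a = (\<lambda>A\<in>open_closed_sets. if a \<in> A then 1 else 0)"

definition proper_set_function :: "('a::t2_space set \<Rightarrow> ennreal) \<Rightarrow> bool" where
  "proper_set_function \<nu> \<longleftrightarrow>
     (\<forall>m. radon_measure m \<and> (\<forall>A\<in>open_closed_sets. emeasure m A \<le> \<nu> A) \<longrightarrow> m = null_measure borel)"

definition pDTM :: "('a::t2_space set \<Rightarrow> ennreal) set" where
  "pDTM = {\<nu>\<in>DTM. proper_set_function \<nu>}"

definition pTM :: "('a::t2_space set \<Rightarrow> ennreal) set" where
  "pTM = {\<mu>\<in>TM. proper_set_function \<mu>}"

definition C0_nonneg :: "('a::t2_space \<Rightarrow> real) set" where
  "C0_nonneg = {f. continuous_on UNIV f \<and> (\<forall>x. 0 \<le> f x) \<and>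
     (\<forall>\<epsilon>>0. \<exists>K. compact K \<and> (\<forall>x. x \<notin> K \<longrightarrow> \<bar>f x\<bar> < \<epsilon>))}"

(* The upper limit is the least admissible one; by dtm_integral_eq below any b with
   f(X) contained in [0,b] gives the same value. *)
definition dtm_integral :: "('a::t2_space set \<Rightarrow> ennreal) \<Rightarrow> ('a \<Rightarrow> real) \<Rightarrow> real" where
  "dtm_integral \<mu> f = integral {0..(SUP x. f x)} (\<lambda>t. enn2real (\<mu> (f -` {t<..})))"

(* The topology generated by the preimages of open sets is the coarsest one making all
   the maps continuous; its underlying set is DTM (take V = UNIV, f = 0). *)
definition weak_topology :: "('a::t2_space set \<Rightarrow> ennreal) topology" where
  "weak_topology =
     topology_generated_by {{\<mu>\<in>DTM. dtm_integral \<mu> f \<in> V} | f V. f \<in> C0_nonneg \<and> open V}"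

definition dense_in :: "('a::t2_space set \<Rightarrow> ennreal) set \<Rightarrow> ('a set \<Rightarrow> ennreal) set \<Rightarrow> bool" where
  "dense_in Y Z \<longleftrightarrow> Z \<subseteq> weak_topology closure_of Y"

lemma topspace_weak_topology: "topspace weak_topology = (DTM :: ('a::t2_space set \<Rightarrow> ennreal) set)"
proof -
  have "(\<lambda>_. 0) \<in> (C0_nonneg :: ('a \<Rightarrow> real) set)"
    unfolding C0_nonneg_def by (auto intro: exI[of _ "{}"])
  then have "{\<mu>\<in>DTM. dtm_integral \<mu> (\<lambda>_::'a. 0) \<in> UNIV}
      \<in> {{\<mu>\<in>DTM. dtm_integral \<mu> f \<in> V} | f V. f \<in> C0_nonneg \<and> open V}"
    by blast
  then show ?thesis
    unfolding weak_topology_def topology_generated_by_topspace by blast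
qed

lemma deficient_topological_measure_empty:
  fixes \<nu> :: "'a::t2_space set \<Rightarrow> ennreal"
  assumes "deficient_topological_measure \<nu>"
  shows "\<nu> {} = 0"
proof (rule ccontr)
  assume "\<nu> {} \<noteq> 0"
  have "\<nu> ({} \<union> {}) = \<nu> {} + \<nu> {}"
    using assms unfolding deficient_topological_measure_def by (metis compact_empty Int_empty_left)
  with \<open>\<nu> {} \<noteq> 0\<close> have top: "\<nu> {} = top"
    by (cases "\<nu> {}") (auto simp flip: ennreal_plus)
  have U: "\<nu> U = top" if "open U" for U
  proof -
    have "\<nu> U = (SUP C\<in>{C. compact C \<and> C \<subseteq> U}. \<nu> C)"
      using assms that unfolding deficient_topological_measure_def inner_compact_on_open_def by blast
    also have "\<dots> \<ge> \<nu> {}" by (rule SUP_upper) auto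
    finally show ?thesis using top by (simp add: top_unique)
  qed
  have "\<nu> F = top" if "closed F" for F
  proof -
    have "\<nu> F = (INF U\<in>{U. open U \<and> F \<subseteq> U}. \<nu> U)"
      using assms that unfolding deficient_topological_measure_def outer_open_on_def by blast
    also have "\<dots> \<ge> top" by (rule INF_greatest) (simp add: U)
    finally show ?thesis by (simp add: top_unique)
  qed
  with U assms show False
    unfolding deficient_topological_measure_def not_identically_infinite_def open_closed_sets_def
    by auto
qed

lemma dtm_integral_eq:
  fixes \<nu> :: "'a::t2_space set \<Rightarrow> ennreal"
  assumes "deficient_topological_measure \<nu>" and "range f \<subseteq> {0..b}"
  shows "dtm_integral \<nu> f = integral {0..b} (\<lambda>t. enn2real (\<nu> (f -` {t<..})))"
proof -
  have bdd: "bdd_above (range f)" using assms(2) by (meson bdd_above.I2 bdd_above_Icc bdd_above_mono)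
  have le: "f x \<le> (SUP x. f x)" for x using bdd by (simp add: cSUP_upper)
  have sb: "(SUP x. f x) \<le> b" using assms(2) by (intro cSUP_least) (auto simp: image_subset_iff)
  have z: "\<nu> (f -` {t<..}) = 0" if "t \<ge> (SUP x. f x)" for t
  proof -
    have "\<not> t < f x" for x using le[of x] that by linarith
    then have "f -` {t<..} = {}" by auto
    then show ?thesis using deficient_topological_measure_empty[OF assms(1)] by simp
  qed
  let ?g = "\<lambda>t. enn2real (\<nu> (f -` {t<..}))"
  have eq: "(\<lambda>t. if t \<in> {0..(SUP x. f x)} then ?g t else 0) = (\<lambda>t. if t \<in> {0..b} then ?g t else 0)"
    (is "?l = ?r")
  proof
    show "?l t = ?r t" for t
      using z[of t] sb by (cases "t \<le> (SUP x. f x)") simp_all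
  qed
  have "dtm_integral \<nu> f = integral UNIV ?l"
    unfolding dtm_integral_def by (rule integral_restrict_UNIV[symmetric])
  also have "\<dots> = integral UNIV ?r" by (simp only: eq)
  also have "\<dots> = integral {0..b} ?g" by (rule integral_restrict_UNIV)
  finally show ?thesis .
qed

end

theory Submission
  imports Defs
begin

text \<open>
  Everything rests on three facts about a finite deficient topological measure \<open>\<nu>\<close>.

  First, \<open>\<nu>\<close> splits as \<open>\<mu> + \<nu>'\<close> with \<open>\<mu>\<close> a finite regular Borel measure and \<open>\<nu>'\<close> proper
  (\<open>DTM_decomposition\<close>). The measure \<open>\<mu>\<close> is the largest one below \<open>\<nu>\<close>. It has an explicit
  formula: extend \<open>\<nu>\<close> to all sets by inner approximation with compact sets, which gives a
  superadditive set function, and pass to the infimum of its sums over finite Borel partitions. The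
  infimum is finitely additive because partitions refine each other. It inherits tightness from
  \<open>\<nu>\<close>, since superadditivity bounds the mass of \<open>E - K\<close> by that of \<open>E\<close> minus that of \<open>K\<close>, and
  tightness turns finite additivity into countable additivity.

  Second, the formula is linear in \<open>\<nu>\<close> (\<open>radon_content_lincomb\<close>) and \<open>\<nu>\<close> is proper exactly if
  it yields zero (\<open>proper_iff_radon_content_UNIV\<close>). Hence nonnegative combinations of proper
  set functions are proper. On the other hand every deficient topological measure is superadditive,
  so a combination can be additive only if each summand with a positive coefficient is
  (\<open>lincomb_TM_imp_right_TM\<close>): adding something can never repair a failure to be a topological
  measure.

  Third, the integral is linear in \<open>\<nu>\<close> and agrees with the Lebesgue integral for measures, so
  finite combinations of point masses approximate every finite measure weakly
  (\<open>dense_in_FBM_if_dense_in_point_masses\<close>).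

  The implications follow. If a cone of set functions comes arbitrarily close to all point masses,
  it comes close to their combinations and hence to all finite measures. If it comes close to the
  measure part \<open>\<mu>\<close> of \<open>\<nu>\<close>, adding the proper part \<open>\<nu>'\<close> brings it close to \<open>\<nu>\<close> without
  leaving the cone. And as soon as some \<open>\<kappa>\<close> fails to be a topological measure, every \<open>\<mu>\<close> is the
  limit of \<open>\<mu> + \<eta> \<kappa>\<close> as \<open>\<eta>\<close> tends to zero, and these fail as well
  (\<open>non_TM_dense_in_DTM\<close>).
\<close>

section \<open>Suprema and infima of sums of extended nonnegative reals\<close>

lemma SUP_plus_SUP_le_ennreal:
  fixes f :: "'i \<Rightarrow> ennreal" and g :: "'j \<Rightarrow> ennreal"
  assumes "I \<noteq> {}" "J \<noteq> {}" "\<And>i j. i \<in> I \<Longrightarrow> j \<in> J \<Longrightarrow> f i + g j \<le> z"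
  shows "(SUP i\<in>I. f i) + (SUP j\<in>J. g j) \<le> z"
proof -
  have "(SUP i\<in>I. f i) + (SUP j\<in>J. g j) = (SUP i\<in>I. SUP j\<in>J. f i + g j)"
    by (simp only: ennreal_SUP_add_left[OF assms(1), symmetric])
      (simp only: ennreal_SUP_add_right[OF assms(2)])
  also have "\<dots> \<le> z" using assms by (intro SUP_least) auto
  finally show ?thesis .
qed

lemma le_INF_plus_INF_ennreal:
  fixes f :: "'i \<Rightarrow> ennreal" and g :: "'j \<Rightarrow> ennreal"
  assumes "\<And>i j. i \<in> I \<Longrightarrow> j \<in> J \<Longrightarrow> z \<le> f i + g j"
  shows "z \<le> (INF i\<in>I. f i) + (INF j\<in>J. g j)"
proof (cases "(INF i\<in>I. f i) = \<infinity> \<or> (INF j\<in>J. g j) = \<infinity>")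
  case True
  then show ?thesis by auto
next
  case False
  show ?thesis
  proof (rule ennreal_le_epsilon)
    fix e :: real assume "0 < e"
    then have e: "0 < e/2" by simp
    obtain i where i: "i \<in> I" "f i < (INF i\<in>I. f i) + ennreal (e/2)"
      using INF_approx_ennreal[OF e, of _ f I] False by auto
    obtain j where j: "j \<in> J" "g j < (INF j\<in>J. g j) + ennreal (e/2)"
      using INF_approx_ennreal[OF e, of _ g J] False by auto
    have "z \<le> f i + g j" using assms i j by blast
    also have "\<dots> \<le> ((INF i\<in>I. f i) + ennreal (e/2)) + ((INF j\<in>J. g j) + ennreal (e/2))"
      using i j by (intro add_mono) auto
    also have "\<dots> = (INF i\<in>I. f i) + (INF j\<in>J. g j) + (ennreal (e/2) + ennreal (e/2))"
      by (simp add: algebra_simps)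
    also have "ennreal (e/2) + ennreal (e/2) = ennreal e"
      using \<open>0 < e\<close> by (subst ennreal_plus[symmetric]) auto
    finally show "z \<le> (INF i\<in>I. f i) + (INF j\<in>J. g j) + ennreal e" .
  qed
qed

lemma INF_mult_left_ennreal:
  fixes c :: ennreal
  assumes "c < top" "I \<noteq> {}"
  shows "c * (INF i\<in>I. f i) = (INF i\<in>I. c * f i)"
proof (cases "c = 0")
  case True
  then show ?thesis using assms by simp
next
  case False
  have le: "d * (INF i\<in>I. h i) \<le> (INF i\<in>I. d * h i)" for d and h :: "_ \<Rightarrow> ennreal"
    by (intro INF_greatest mult_left_mono INF_lower) auto
  \<comment> \<open>The inequality \<open>le\<close>, applied to \<open>inverse c\<close>, gives its own converse.\<close>
  have inv: "c * inverse c = 1" "inverse c * c = 1"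
    using ennreal_divide_self[of c] False assms by (auto simp: divide_ennreal_def mult.commute)
  have "(INF i\<in>I. c * f i) = c * (inverse c * (INF i\<in>I. c * f i))"
    by (simp add: mult.assoc[symmetric] inv)
  also have "\<dots> \<le> c * (INF i\<in>I. inverse c * (c * f i))"
    by (intro mult_left_mono le) auto
  also have "\<dots> = c * (INF i\<in>I. f i)" by (simp add: mult.assoc[symmetric] inv)
  finally show ?thesis by (intro antisym le)
qed

section \<open>Additive minorants of superadditive set functions\<close>

definition superadditive_set_function :: "('a set \<Rightarrow> ennreal) \<Rightarrow> bool" where
  "superadditive_set_function s \<longleftrightarrow>
     s {} = 0 \<and> (\<forall>A B. A \<inter> B = {} \<longrightarrow> s A + s B \<le> s (A \<union> B))"

lemma superadditive_sum_le:
  assumes "superadditive_set_function s" "finite I" "disjoint_family_on F I"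
  shows "(\<Sum>i\<in>I. s (F i)) \<le> s (\<Union>i\<in>I. F i)"
  using assms(2,3)
proof (induction I rule: finite_induct)
  case empty
  then show ?case by simp
next
  case (insert i I)
  have "F i \<inter> (\<Union>j\<in>I. F j) = {}"
    using insert.prems insert.hyps by (auto simp: disjoint_family_on_def)
  then have "s (F i) + s (\<Union>j\<in>I. F j) \<le> s (F i \<union> (\<Union>j\<in>I. F j))"
    using assms(1) unfolding superadditive_set_function_def by blast
  moreover have "(\<Sum>j\<in>I. s (F j)) \<le> s (\<Union>j\<in>I. F j)"
    using insert by (auto simp: disjoint_family_on_def)
  ultimately show ?case
    using insert.hyps by (auto intro: order_trans[OF add_left_mono])
qed

definition borel_partitions :: "'a::topological_space set \<Rightarrow> 'a set set set" where
  "borel_partitions E = {P. finite P \<and> disjoint P \<and> \<Union>P = E \<and> P \<subseteq> sets borel}"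

text \<open>The largest finitely additive set function on the Borel sets below \<open>s\<close>, when \<open>s\<close> is
superadditive. Only Borel pieces are admitted: cutting along arbitrary sets would make the infimum
too small, since for inner Lebesgue measure there are nonmeasurable sets of inner measure zero
whose complement has inner measure zero too.\<close>

definition additive_minorant :: "('a::topological_space set \<Rightarrow> ennreal) \<Rightarrow> 'a set \<Rightarrow> ennreal" where
  "additive_minorant s E = (INF P\<in>borel_partitions E. \<Sum>A\<in>P. s A)"

lemma singleton_borel_partition: "E \<in> sets borel \<Longrightarrow> {E} \<in> borel_partitions E"
  by (auto simp: borel_partitions_def disjoint_def)

lemma additive_minorant_le: "E \<in> sets borel \<Longrightarrow> additive_minorant s E \<le> s E"
  unfolding additive_minorant_def
  by (rule INF_lower2[OF singleton_borel_partition]) auto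

lemma inter_borel_partition:
  assumes "P \<in> borel_partitions E" "F \<in> sets borel" "F \<subseteq> E"
  shows "(\<lambda>A. A \<inter> F) ` P \<in> borel_partitions F"
  using assms unfolding borel_partitions_def disjoint_def by (auto; fast)

lemma sum_image_le_ennreal: "finite I \<Longrightarrow> sum s (f ` I) \<le> (\<Sum>i\<in>I. s (f i) :: ennreal)"
  using sum_image_le[of I s f] by (simp add: o_def)

lemma borel_partition_union:
  assumes "P \<in> borel_partitions E" "Q \<in> borel_partitions F" "E \<inter> F = {}"
  shows "P \<union> Q \<in> borel_partitions (E \<union> F)"
  using assms disjoint_union[of P Q] by (auto simp: borel_partitions_def)

text \<open>Partitions of the two parts unite to a partition of the union, which gives one inequality. Conversely
a partition of the union is cut along \<open>E\<close> and \<open>F\<close>, and superadditivity ensures that cutting does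
not increase the sum.\<close>

lemma additive_minorant_union:
  assumes s: "superadditive_set_function s" and EF: "E \<in> sets borel" "F \<in> sets borel" "E \<inter> F = {}"
  shows "additive_minorant s (E \<union> F) = additive_minorant s E + additive_minorant s F"
proof (rule antisym)
  show "additive_minorant s (E \<union> F) \<le> additive_minorant s E + additive_minorant s F"
    unfolding additive_minorant_def[of s E] additive_minorant_def[of s F]
  proof (rule le_INF_plus_INF_ennreal)
    fix P Q assume PQ: "P \<in> borel_partitions E" "Q \<in> borel_partitions F"
    have fin: "finite P" "finite Q" using PQ by (auto simp: borel_partitions_def)
    have "additive_minorant s (E \<union> F) \<le> sum s (P \<union> Q)"
      unfolding additive_minorant_def by (rule INF_lower[OF borel_partition_union[OF PQ EF(3)]])
    also have "\<dots> \<le> sum s (P \<union> Q) + sum s (P \<inter> Q)" by simp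
    also have "\<dots> = sum s P + sum s Q" by (rule sum.union_inter[OF fin])
    finally show "additive_minorant s (E \<union> F) \<le> sum s P + sum s Q" .
  qed
next
  show "additive_minorant s E + additive_minorant s F \<le> additive_minorant s (E \<union> F)"
    unfolding additive_minorant_def[of s "E \<union> F"]
  proof (rule INF_greatest)
    fix P assume P: "P \<in> borel_partitions (E \<union> F)"
    have fin: "finite P" using P by (auto simp: borel_partitions_def)
    have "additive_minorant s E + additive_minorant s F
        \<le> sum s ((\<lambda>A. A \<inter> E) ` P) + sum s ((\<lambda>A. A \<inter> F) ` P)"
      unfolding additive_minorant_def using EF
      by (intro add_mono INF_lower inter_borel_partition[OF P]) auto
    also have "\<dots> \<le> (\<Sum>A\<in>P. s (A \<inter> E)) + (\<Sum>A\<in>P. s (A \<inter> F))"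
      by (intro add_mono sum_image_le_ennreal fin)
    also have "\<dots> = (\<Sum>A\<in>P. s (A \<inter> E) + s (A \<inter> F))" by (simp add: sum.distrib)
    also have "\<dots> \<le> sum s P"
    proof (rule sum_mono)
      fix A assume "A \<in> P"
      then have "(A \<inter> E) \<union> (A \<inter> F) = A" using P by (auto simp: borel_partitions_def)
      moreover have "(A \<inter> E) \<inter> (A \<inter> F) = {}" using EF by auto
      ultimately show "s (A \<inter> E) + s (A \<inter> F) \<le> s A"
        using s unfolding superadditive_set_function_def by metis
    qed
    finally show "additive_minorant s E + additive_minorant s F \<le> sum s P" .
  qed
qed

text \<open>For a superadditive \<open>s\<close> the sums decrease under refinement. This is what lets one partition be
nearly optimal for two set functions at once, and so makes the additive minorant linear.\<close>

lemma common_refinement: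
  assumes P: "P \<in> borel_partitions E" and Q: "Q \<in> borel_partitions E"
  obtains R where "R \<in> borel_partitions E"
    "\<And>s. superadditive_set_function s \<Longrightarrow> sum s R \<le> sum s P"
    "\<And>s. superadditive_set_function s \<Longrightarrow> sum s R \<le> sum s Q"
proof
  let ?f = "\<lambda>(A,B). A \<inter> B"
  \<comment> \<open>Distinct pairs may have the same (empty) intersection, so sums over the image are only
     bounded by sums over pairs.\<close>
  let ?R = "?f ` (P \<times> Q)"
  have fin: "finite P" "finite Q" and dis: "disjoint P" "disjoint Q" and un: "\<Union>P = E" "\<Union>Q = E"
    using P Q by (auto simp: borel_partitions_def)
  have "disjoint ?R"
  proof (rule disjointI)
    fix C D assume "C \<in> ?R" "D \<in> ?R" and ne: "C \<noteq> D"
    then obtain A B A' B' where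
      *: "A \<in> P" "B \<in> Q" "A' \<in> P" "B' \<in> Q" and CD: "C = A \<inter> B" "D = A' \<inter> B'" by auto
    with ne have "A \<noteq> A' \<or> B \<noteq> B'" by blast
    with * dis have "A \<inter> A' = {} \<or> B \<inter> B' = {}" unfolding disjoint_def by blast
    then show "C \<inter> D = {}" using CD by blast
  qed
  moreover have "\<Union>?R = E" using un by auto
  moreover have "?R \<subseteq> sets borel" using P Q by (auto simp: borel_partitions_def)
  ultimately show "?R \<in> borel_partitions E" using fin by (auto simp: borel_partitions_def)
  have split: "(\<Sum>B\<in>Q'. s (A \<inter> B)) \<le> s A"
    if "superadditive_set_function s" "finite Q'" "disjoint Q'" "A \<subseteq> \<Union>Q'"
    for s :: "'a set \<Rightarrow> ennreal" and A Q'
  proof -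
    have "disjoint_family_on (\<lambda>B. A \<inter> B) Q'"
      using that(3) by (auto simp: disjoint_family_on_def disjoint_def)
    then have "(\<Sum>B\<in>Q'. s (A \<inter> B)) \<le> s (\<Union>B\<in>Q'. A \<inter> B)"
      by (rule superadditive_sum_le[OF that(1,2)])
    also have "(\<Union>B\<in>Q'. A \<inter> B) = A" using that(4) by blast
    finally show ?thesis .
  qed
  fix s :: "'a set \<Rightarrow> ennreal" assume s: "superadditive_set_function s"
  have R: "sum s ?R \<le> (\<Sum>A\<in>P. \<Sum>B\<in>Q. s (A \<inter> B))"
    using sum_image_le_ennreal[of "P \<times> Q" s ?f] fin
    by (simp add: sum.cartesian_product case_prod_unfold)
  also have "\<dots> \<le> sum s P"
    using s fin dis un by (intro sum_mono split) auto
  finally show "sum s ?R \<le> sum s P" .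
  note R
  also have "(\<Sum>A\<in>P. \<Sum>B\<in>Q. s (A \<inter> B)) = (\<Sum>B\<in>Q. \<Sum>A\<in>P. s (B \<inter> A))"
    by (subst sum.swap) (simp add: Int_commute)
  also have "\<dots> \<le> sum s Q"
    using s fin dis un by (intro sum_mono split) auto
  finally show "sum s ?R \<le> sum s Q" .
qed

lemma additive_minorant_lincomb:
  assumes s: "superadditive_set_function s" and t: "superadditive_set_function t"
    and ab: "a < top" "b < top" and E: "E \<in> sets borel"
  shows "additive_minorant (\<lambda>A. a * s A + b * t A) E
    = a * additive_minorant s E + b * additive_minorant t E"
proof (rule antisym)
  have ne: "borel_partitions E \<noteq> {}" using singleton_borel_partition[OF E] by auto
  have sum: "(\<Sum>A\<in>P. a * s A + b * t A) = a * sum s P + b * sum t P" for P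
    by (simp add: sum.distrib sum_distrib_left)
  show "additive_minorant (\<lambda>A. a * s A + b * t A) E
    \<le> a * additive_minorant s E + b * additive_minorant t E"
    unfolding additive_minorant_def[of s] additive_minorant_def[of t] INF_mult_left_ennreal[OF ab(1) ne]
      INF_mult_left_ennreal[OF ab(2) ne]
  proof (rule le_INF_plus_INF_ennreal)
    fix P Q assume PQ: "P \<in> borel_partitions E" "Q \<in> borel_partitions E"
    obtain R where R: "R \<in> borel_partitions E" "sum s R \<le> sum s P" "sum t R \<le> sum t Q"
      using common_refinement[OF PQ] s t by metis
    have "additive_minorant (\<lambda>A. a * s A + b * t A) E \<le> (\<Sum>A\<in>R. a * s A + b * t A)"
      unfolding additive_minorant_def by (rule INF_lower[OF R(1)])
    also have "\<dots> \<le> a * sum s P + b * sum t Q"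
      unfolding sum using R by (intro add_mono mult_left_mono) auto
    finally show "additive_minorant (\<lambda>A. a * s A + b * t A) E \<le> a * sum s P + b * sum t Q" .
  qed
  show "a * additive_minorant s E + b * additive_minorant t E
    \<le> additive_minorant (\<lambda>A. a * s A + b * t A) E"
    unfolding additive_minorant_def[of "\<lambda>A. a * s A + b * t A"] sum
    by (intro INF_greatest add_mono mult_left_mono) (auto simp: additive_minorant_def intro: INF_lower)
qed

section \<open>Superadditivity and inner extension of deficient topological measures\<close>

lemma in_open_closed_sets [simp]:
  "open A \<Longrightarrow> A \<in> open_closed_sets" "closed A \<Longrightarrow> A \<in> open_closed_sets"
  by (auto simp: open_closed_sets_def)

lemma compact_in_open_closed_sets [simp]:
  "compact (A :: 'a::t2_space set) \<Longrightarrow> A \<in> open_closed_sets"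
  by (simp add: compact_imp_closed)

lemma open_closed_sets_borel: "A \<in> open_closed_sets \<Longrightarrow> A \<in> sets borel"
  by (auto simp: open_closed_sets_def)

lemma DTM_compact_union:
  "\<nu> \<in> DTM \<Longrightarrow> compact C \<Longrightarrow> compact K \<Longrightarrow> C \<inter> K = {} \<Longrightarrow> \<nu> (C \<union> K) = \<nu> C + \<nu> K"
  by (auto simp: DTM_def deficient_topological_measure_def)

lemma DTM_open: "\<nu> \<in> DTM \<Longrightarrow> open U \<Longrightarrow> \<nu> U = (SUP C\<in>{C. compact C \<and> C \<subseteq> U}. \<nu> C)"
  by (auto simp: DTM_def deficient_topological_measure_def inner_compact_on_open_def)

lemma DTM_closed: "\<nu> \<in> DTM \<Longrightarrow> closed F \<Longrightarrow> \<nu> F = (INF U\<in>{U. open U \<and> F \<subseteq> U}. \<nu> U)"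
  by (auto simp: DTM_def deficient_topological_measure_def outer_open_on_def)

lemma DTM_empty: "\<nu> \<in> DTM \<Longrightarrow> \<nu> {} = 0"
  using deficient_topological_measure_empty by (auto simp: DTM_def)

lemma DTM_mono:
  fixes \<nu> :: "'a::t2_space set \<Rightarrow> ennreal"
  assumes \<nu>: "\<nu> \<in> DTM" and A: "A \<in> open_closed_sets" and B: "B \<in> open_closed_sets" and "A \<subseteq> B"
  shows "\<nu> A \<le> \<nu> B"
proof -
  have into_open: "\<nu> A \<le> \<nu> U" if "open U" "A \<subseteq> U" for U
  proof (cases "open A")
    case True
    show ?thesis unfolding DTM_open[OF \<nu> True] DTM_open[OF \<nu> that(1)]
      using that by (intro SUP_subset_mono) auto
  next
    case False
    then have "closed A" using A by (auto simp: open_closed_sets_def)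
    then show ?thesis using DTM_closed[OF \<nu>, of A] that by (auto intro: INF_lower)
  qed
  show ?thesis
  proof (cases "open B")
    case True
    then show ?thesis using into_open \<open>A \<subseteq> B\<close> by auto
  next
    case False
    then have "closed B" using B by (auto simp: open_closed_sets_def)
    show ?thesis unfolding DTM_closed[OF \<nu> \<open>closed B\<close>]
      using \<open>A \<subseteq> B\<close> by (intro INF_greatest into_open) auto
  qed
qed

lemma DTM_finite:
  assumes "\<nu> \<in> DTM" "A \<in> open_closed_sets"
  shows "\<nu> A < top"
  using DTM_mono[OF assms, of UNIV] assms(1) by (auto simp: DTM_def less_top[symmetric] top_unique)

text \<open>Only values on compact sets enter. On closed sets that are not compact the extension may be strictly
smaller than \<open>\<nu>\<close>; it agrees with \<open>\<nu>\<close> on open and on compact sets.\<close>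

definition inner_extension :: "('a::topological_space set \<Rightarrow> ennreal) \<Rightarrow> 'a set \<Rightarrow> ennreal" where
  "inner_extension \<nu> E = (SUP K\<in>{K. compact K \<and> K \<subseteq> E}. \<nu> K)"

lemma inner_extension_upper: "compact K \<Longrightarrow> K \<subseteq> E \<Longrightarrow> \<nu> K \<le> inner_extension \<nu> E"
  unfolding inner_extension_def by (rule SUP_upper) auto

lemma inner_extension_open: "\<nu> \<in> DTM \<Longrightarrow> open U \<Longrightarrow> inner_extension \<nu> U = \<nu> U"
  using DTM_open[of \<nu> U] by (simp add: inner_extension_def)

lemma inner_extension_le:
  assumes "\<nu> \<in> DTM" "A \<in> open_closed_sets"
  shows "inner_extension \<nu> A \<le> \<nu> A"
  unfolding inner_extension_def by (intro SUP_least DTM_mono assms) auto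

lemma inner_extension_compact: "\<nu> \<in> DTM \<Longrightarrow> compact K \<Longrightarrow> inner_extension \<nu> K = \<nu> K"
  using inner_extension_upper[of K K \<nu>] inner_extension_le[of \<nu> K] by (simp add: antisym)

lemma inner_extension_superadditive:
  fixes \<nu> :: "'a::t2_space set \<Rightarrow> ennreal"
  assumes "\<nu> \<in> DTM"
  shows "superadditive_set_function (inner_extension \<nu>)"
  unfolding superadditive_set_function_def
proof (intro conjI allI impI)
  show "inner_extension \<nu> {} = 0" using assms by (simp add: inner_extension_open DTM_empty)
  fix A B :: "'a set" assume AB: "A \<inter> B = {}"
  show "inner_extension \<nu> A + inner_extension \<nu> B \<le> inner_extension \<nu> (A \<union> B)"
    unfolding inner_extension_def[of _ A] inner_extension_def[of _ B]
  proof (rule SUP_plus_SUP_le_ennreal)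
    fix C K assume *: "C \<in> {K. compact K \<and> K \<subseteq> A}" "K \<in> {K. compact K \<and> K \<subseteq> B}"
    then have "C \<inter> K = {}" using AB by auto
    then have "\<nu> C + \<nu> K = \<nu> (C \<union> K)" using DTM_compact_union[OF assms] * by auto
    also have "\<dots> \<le> inner_extension \<nu> (A \<union> B)" using * by (intro inner_extension_upper) auto
    finally show "\<nu> C + \<nu> K \<le> inner_extension \<nu> (A \<union> B)" .
  qed (auto intro: exI[of _ "{}"])
qed

lemma DTM_superadditive:
  assumes "\<nu> \<in> DTM" "compact A \<or> open A" "compact B \<or> open B" "compact (A \<union> B) \<or> open (A \<union> B)"
    "A \<inter> B = {}"
  shows "\<nu> A + \<nu> B \<le> \<nu> (A \<union> B)"
proof -
  have "inner_extension \<nu> C = \<nu> C" if "compact C \<or> open C" for C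
    using that assms(1) inner_extension_open inner_extension_compact by metis
  then show ?thesis
    using inner_extension_superadditive[OF assms(1)] assms(2-)
    unfolding superadditive_set_function_def by metis
qed

text \<open>\<open>A\<close> may be closed without being compact, so superadditivity of the inner extension does not apply
to it. The open set \<open>U - C\<close> serves as a substitute for \<open>A\<close>.\<close>

lemma DTM_superadditive_below_open:
  assumes \<nu>: "\<nu> \<in> DTM" and "open U" "A \<in> open_closed_sets" "compact C" "A \<subseteq> U" "C \<subseteq> U" "A \<inter> C = {}"
  shows "\<nu> A + \<nu> C \<le> \<nu> U"
proof -
  have op: "open (U - C)" using assms by (intro open_Diff compact_imp_closed)
  have "\<nu> A \<le> \<nu> (U - C)" using assms op by (intro DTM_mono) auto
  moreover have "\<nu> (U - C) + \<nu> C \<le> \<nu> ((U - C) \<union> C)"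
    using assms op by (intro DTM_superadditive[OF \<nu>]) (auto simp: Un_absorb2)
  moreover have "(U - C) \<union> C = U" using assms by auto
  ultimately show ?thesis by (metis add_right_mono order_trans)
qed

lemma TM_subset_DTM: "TM \<subseteq> (DTM :: ('a::t2_space set \<Rightarrow> ennreal) set)"
  unfolding TM_def DTM_def topological_measure_def deficient_topological_measure_def
  by (auto intro: compact_Un)

section \<open>Regular measures as topological measures\<close>

text \<open>By finiteness the whole space is a compact \<open>K\<close> up to a small set, and outer regularity of \<open>- E\<close>
provides an open \<open>V\<close> that covers \<open>- E\<close> with small excess; then \<open>K - V\<close> is a compact subset of
\<open>E\<close> that misses little.\<close>

lemma regular_borel_measure_inner_compact:
  fixes m :: "'a::t2_space measure"
  assumes "finite_measure m" and m: "regular_borel_measure m" and E: "E \<in> sets borel"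
  shows "inner_extension (emeasure m) E = emeasure m E"
proof (rule antisym)
  interpret finite_measure m by fact
  have sets: "sets m = sets borel" using m by (simp add: regular_borel_measure_def)
  have meas: "A \<in> sets m" if "compact A \<or> open A" for A :: "'a set"
    using that by (auto simp: sets compact_imp_closed)
  show "inner_extension (emeasure m) E \<le> emeasure m E"
    unfolding inner_extension_def using E sets by (intro SUP_least emeasure_mono) auto
  show "emeasure m E \<le> inner_extension (emeasure m) E"
  proof (rule ennreal_le_epsilon)
    fix e :: real assume "0 < e"
    then have e: "0 < e/2" by simp
    have "emeasure m UNIV = (SUP C\<in>{C. compact C \<and> C \<subseteq> UNIV}. emeasure m C)"
      using m unfolding regular_borel_measure_def inner_compact_on_open_def by blast
    moreover have "{C. compact C \<and> C \<subseteq> (UNIV :: 'a set)} \<noteq> {}" using compact_empty by blast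
    ultimately obtain K where
      K: "compact K" "emeasure m UNIV < emeasure m K + ennreal (e/2)"
      using SUP_approx_ennreal[OF e, of "{C. compact C \<and> C \<subseteq> UNIV}" "emeasure m UNIV" "emeasure m"]
        emeasure_finite[of UNIV] by auto
    have "emeasure m (- E) = (INF U\<in>{U. open U \<and> - E \<subseteq> U}. emeasure m U)"
      using m E unfolding regular_borel_measure_def outer_open_on_def by (metis borel_comp)
    from INF_approx_ennreal[OF e this] obtain V where
      V: "open V" "- E \<subseteq> V" "emeasure m V < emeasure m (- E) + ennreal (e/2)"
      using emeasure_finite[of "- E"] by (auto simp: less_top)
    have C: "compact (K - V)" using K V by (intro compact_diff)
    have UN: "(UNIV :: 'a set) \<in> sets m" using sets by simp
    have r: "measure m UNIV < measure m K + e/2" "measure m V < measure m (- E) + e/2"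
      using K(2) V(3) \<open>0 < e\<close>
      by (simp_all add: emeasure_eq_measure ennreal_less_iff flip: ennreal_plus)
    have "measure m UNIV = measure m E + measure m (- E)"
      using finite_measure_Union[of E "- E"] E sets by (simp add: Compl_partition)
    moreover have "measure m K \<le> measure m ((K - V) \<union> V)"
      using meas[of "K - V"] meas[of V] C V by (intro finite_measure_mono sets.Un) auto
    moreover have "measure m ((K - V) \<union> V) \<le> measure m (K - V) + measure m V"
      using meas[of "K - V"] meas[of V] C V by (intro measure_Un_le) auto
    ultimately have "measure m E \<le> measure m (K - V) + e" using r by linarith
    then have "emeasure m E \<le> emeasure m (K - V) + ennreal e"
      using \<open>0 < e\<close> by (simp add: emeasure_eq_measure flip: ennreal_plus)
    also have "\<dots> \<le> inner_extension (emeasure m) E + ennreal e"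
      using C V by (intro add_right_mono inner_extension_upper) auto
    finally show "emeasure m E \<le> inner_extension (emeasure m) E + ennreal e" .
  qed
qed

lemma FBM_subset_TM: "FBM \<subseteq> (TM :: ('a::t2_space set \<Rightarrow> ennreal) set)"
proof
  fix \<mu> :: "'a set \<Rightarrow> ennreal" assume "\<mu> \<in> FBM"
  then obtain m where \<mu>: "\<mu> = restrict (emeasure m) open_closed_sets"
    and fin: "finite_measure m" and m: "regular_borel_measure m" by (auto simp: FBM_def)
  have sets: "sets m = sets borel" and inner: "inner_compact_on_open (emeasure m)"
    and outer: "outer_open_on (sets borel) (emeasure m)"
    using m by (auto simp: regular_borel_measure_def)
  have eq: "\<mu> A = emeasure m A" if "A \<in> open_closed_sets" for A using that by (simp add: \<mu>)
  have UN: "\<mu> UNIV < \<infinity>"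
    using finite_measure.emeasure_finite[OF fin, of UNIV] by (simp add: eq less_top)
  have "topological_measure \<mu>"
    unfolding topological_measure_def
  proof (intro conjI allI impI)
    show "\<mu> \<in> extensional open_closed_sets" by (simp add: \<mu>)
    show "not_identically_infinite \<mu>"
      using UN unfolding not_identically_infinite_def by (intro bexI[of _ UNIV]) auto
    show "inner_compact_on_open \<mu>"
      using inner unfolding inner_compact_on_open_def by (simp add: eq)
    show "outer_open_on {F. closed F} \<mu>"
      using outer unfolding outer_open_on_def by (simp add: eq)
    fix A B :: "'a set"
    assume *: "(compact A \<or> open A) \<and> (compact B \<or> open B) \<and> (compact (A \<union> B) \<or> open (A \<union> B)) \<and>
        A \<inter> B = {}"
    have ocs: "C \<in> open_closed_sets" if "compact C \<or> open C" for C :: "'a set"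
      using that by auto
    have AB: "A \<in> open_closed_sets" "B \<in> open_closed_sets" "A \<union> B \<in> open_closed_sets"
      using * ocs by blast+
    then have "A \<in> sets m" "B \<in> sets m" unfolding sets by (auto intro: open_closed_sets_borel)
    then have "emeasure m A + emeasure m B = emeasure m (A \<union> B)" using * by (intro plus_emeasure) auto
    then show "\<mu> (A \<union> B) = \<mu> A + \<mu> B" unfolding eq[OF AB(1)] eq[OF AB(2)] eq[OF AB(3)] by (rule sym)
  qed
  then show "\<mu> \<in> TM" using UN by (simp add: TM_def)
qed

section \<open>The largest regular measure below a deficient topological measure\<close>

abbreviation radon_content :: "('a::topological_space set \<Rightarrow> ennreal) \<Rightarrow> 'a set \<Rightarrow> ennreal" where
  "radon_content \<nu> \<equiv> additive_minorant (inner_extension \<nu>)"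

definition radon_part :: "('a::topological_space set \<Rightarrow> ennreal) \<Rightarrow> 'a measure" where
  "radon_part \<nu> = measure_of UNIV (sets borel) (radon_content \<nu>)"

lemma inner_extension_finite:
  assumes "\<nu> \<in> DTM"
  shows "inner_extension \<nu> E < top"
proof -
  have "inner_extension \<nu> E \<le> inner_extension \<nu> UNIV"
    unfolding inner_extension_def by (intro SUP_subset_mono) auto
  also have "\<dots> < top" using assms by (simp add: inner_extension_open DTM_finite)
  finally show ?thesis .
qed

text \<open>If \<open>\<nu> K\<close> nearly exhausts the inner extension on \<open>E\<close>, superadditivity leaves little room for
\<open>E - K\<close>, and the additive minorant is smaller still.\<close>

lemma radon_content_compact_approx:
  fixes \<nu> :: "'a::t2_space set \<Rightarrow> ennreal"
  assumes \<nu>: "\<nu> \<in> DTM" and E: "E \<in> sets borel" and e: "0 < (e::real)"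
  obtains K where "compact K" "K \<subseteq> E" "radon_content \<nu> (E - K) \<le> ennreal e"
proof -
  have "inner_extension \<nu> E \<noteq> \<infinity>" using inner_extension_finite[OF \<nu>, of E] by auto
  moreover have "{K. compact K \<and> K \<subseteq> E} \<noteq> {}" by auto
  ultimately obtain K where
    K: "compact K" "K \<subseteq> E" and less: "inner_extension \<nu> E < \<nu> K + ennreal e"
    using SUP_approx_ennreal[OF e _ inner_extension_def, of E \<nu>] by auto
  have "\<nu> K + inner_extension \<nu> (E - K) \<le> inner_extension \<nu> (K \<union> (E - K))"
    using inner_extension_superadditive[OF \<nu>] inner_extension_compact[OF \<nu> K(1)]
    unfolding superadditive_set_function_def by (metis Diff_disjoint)
  also have "K \<union> (E - K) = E" using K by auto
  also note less
  finally have "inner_extension \<nu> (E - K) < ennreal e"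
    using ennreal_add_left_cancel_less by blast
  moreover have "E - K \<in> sets borel" using E K by (simp add: compact_imp_closed sets.Diff)
  ultimately have "radon_content \<nu> (E - K) \<le> ennreal e"
    using additive_minorant_le[of "E - K" "inner_extension \<nu>"] by auto
  with K that show ?thesis by blast
qed

lemma radon_content_empty: "\<nu> \<in> DTM \<Longrightarrow> radon_content \<nu> {} = 0"
  using additive_minorant_le[of "{}" "inner_extension \<nu>"]
  by (simp add: inner_extension_open DTM_empty)

lemma radon_content_finite: "\<nu> \<in> DTM \<Longrightarrow> E \<in> sets borel \<Longrightarrow> radon_content \<nu> E < top"
  using additive_minorant_le[of E "inner_extension \<nu>"] inner_extension_finite[of \<nu> E] by auto

text \<open>A tight finitely additive set function is countably additive: if Borel sets \<open>A i\<close> decrease to the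
empty set and compact \<open>K i\<close> nearly fill them, finitely many of the \<open>K i\<close> already have empty
intersection, so \<open>A n\<close> is eventually covered by finitely many of the small sets \<open>A i - K i\<close>.\<close>

lemma radon_content_countably_additive:
  fixes \<nu> :: "'a::t2_space set \<Rightarrow> ennreal"
  assumes \<nu>: "\<nu> \<in> DTM"
  shows "countably_additive (sets borel) (radon_content \<nu>)"
proof (rule sets.empty_continuous_imp_countably_additive)
  let ?r = "radon_content \<nu>"
  show pos: "positive (sets borel) ?r" by (simp add: positive_def radon_content_empty[OF \<nu>])
  show add: "additive (sets borel) ?r"
    using additive_minorant_union[OF inner_extension_superadditive[OF \<nu>]] by (simp add: additive_def)
  show "\<forall>A\<in>sets borel. ?r A \<noteq> \<infinity>" using radon_content_finite[OF \<nu>] by fastforce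
  fix A :: "nat \<Rightarrow> 'a set"
  assume A: "range A \<subseteq> sets borel" "decseq A" "(\<Inter>i. A i) = {}"
  have mono: "?r B \<le> ?r C" if "B \<in> sets borel" "C \<in> sets borel" "B \<subseteq> C" for B C
    using sets.additive_increasing[OF pos add] that by (auto simp: increasing_def)
  show "(\<lambda>i. ?r (A i)) \<longlonglongrightarrow> 0"
  proof (rule order_tendstoI)
    fix c :: ennreal assume "0 < c"
    then obtain c' where c': "0 < c'" "c' < c" using dense by blast
    then obtain e where ce: "c' = ennreal e" and "0 \<le> e" by (cases c') auto
    then have e: "0 < e" using c' by simp
    define d where "d i = e * (1/2) ^ Suc i" for i
    have dpos: "0 < d i" for i using e by (simp add: d_def)
    have "\<exists>K. compact K \<and> K \<subseteq> A i \<and> ?r (A i - K) \<le> ennreal (d i)" for i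
      by (rule radon_content_compact_approx[OF \<nu> _ dpos[of i], of "A i"]) (use A(1) in auto)
    then obtain K where K: "\<And>i. compact (K i)" "\<And>i. K i \<subseteq> A i" "\<And>i. ?r (A i - K i) \<le> ennreal (d i)"
      by metis
    \<comment> \<open>\<open>K 0\<close> is the compact set in which the finite intersection property is used.\<close>
    have "(K 0) \<inter> (\<Inter>i\<in>UNIV. K i) = {}" using A(3) K(2) by blast
    then obtain J where J: "finite J" "K 0 \<inter> (\<Inter>i\<in>J. K i) = {}"
      using compact_imp_fip_image[OF K(1), of UNIV K] K(1) compact_imp_closed by metis
    define N where "N = Max (insert 0 J)"
    have N: "i \<le> N" if "i \<in> insert 0 J" for i using J(1) that by (simp add: N_def)
    show "eventually (\<lambda>n. ?r (A n) < c) sequentially"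
    proof (rule eventually_sequentiallyI)
      fix n assume n: "N \<le> n"
      have AK: "A i - K i \<in> sets borel" for i
        using A(1) K(1) by (auto intro!: sets.Diff simp: compact_imp_closed)
      have "A n \<subseteq> (\<Union>i\<in>{..N}. A i - K i)"
      proof
        fix x assume x: "x \<in> A n"
        obtain i where i: "i \<in> insert 0 J" "x \<notin> K i" using J(2) by blast
        have "x \<in> A i" using decseqD[OF A(2), of i n] N[OF i(1)] n x by auto
        then show "x \<in> (\<Union>i\<in>{..N}. A i - K i)" using i N by auto
      qed
      then have "?r (A n) \<le> ?r (\<Union>i\<in>{..N}. A i - K i)"
        using A(1) AK by (intro mono) auto
      also have "\<dots> \<le> (\<Sum>i\<in>{..N}. ?r (A i - K i))"
        using AK by (intro sets.subadditive[OF pos add]) auto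
      also have "\<dots> \<le> (\<Sum>i\<in>{..N}. ennreal (d i))" by (intro sum_mono K)
      also have "\<dots> = ennreal (\<Sum>i\<in>{..N}. d i)"
        using dpos by (intro sum_ennreal) (simp add: less_imp_le)
      also have "\<dots> \<le> ennreal e"
      proof (rule ennreal_leI)
        have "(\<Sum>i\<in>{..N}. d i) = e * (1 - (1/2) ^ Suc N)"
          by (induction N) (simp_all add: d_def field_simps)
        then show "(\<Sum>i\<in>{..N}. d i) \<le> e" using e by simp
      qed
      also have "\<dots> < c" using c' ce by simp
      finally show "?r (A n) < c" .
    qed
  qed auto
qed

lemma
  fixes \<nu> :: "'a::t2_space set \<Rightarrow> ennreal"
  assumes \<nu>: "\<nu> \<in> DTM"
  shows sets_radon_part: "sets (radon_part \<nu>) = sets borel"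
    and emeasure_radon_part: "E \<in> sets borel \<Longrightarrow> emeasure (radon_part \<nu>) E = radon_content \<nu> E"
proof -
  have sa: "sigma_algebra UNIV (sets (borel :: 'a measure))"
    using sets.sigma_algebra_axioms[of "borel :: 'a measure"] by simp
  show "sets (radon_part \<nu>) = sets borel"
    unfolding radon_part_def using sa by (simp add: sigma_algebra.sigma_sets_eq)
  show "emeasure (radon_part \<nu>) E = radon_content \<nu> E" if "E \<in> sets borel"
    using that unfolding radon_part_def
    by (intro emeasure_measure_of_sigma sa radon_content_countably_additive[OF \<nu>])
       (simp add: positive_def radon_content_empty[OF \<nu>])
qed

text \<open>Both regularity properties come from tightness; outer regularity of \<open>E\<close> is tightness of \<open>- E\<close>,
because compact sets have open complements.\<close>

lemma radon_part_regular:
  fixes \<nu> :: "'a::t2_space set \<Rightarrow> ennreal"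
  assumes \<nu>: "\<nu> \<in> DTM"
  shows "finite_measure (radon_part \<nu>)" "regular_borel_measure (radon_part \<nu>)"
    and "A \<in> open_closed_sets \<Longrightarrow> emeasure (radon_part \<nu>) A \<le> \<nu> A"
proof -
  let ?m = "radon_part \<nu>"
  note sets = sets_radon_part[OF \<nu>]
  have sp: "space ?m = UNIV" using sets_eq_imp_space_eq[OF sets] by simp
  show "finite_measure ?m"
    using radon_content_finite[OF \<nu>, of UNIV]
    by (intro finite_measureI) (simp add: sp emeasure_radon_part[OF \<nu>])
  have approx: "\<exists>K. compact K \<and> K \<subseteq> E \<and> emeasure ?m (E - K) \<le> ennreal e"
    if E: "E \<in> sets borel" and e: "0 < e" for E e
  proof -
    from radon_content_compact_approx[OF \<nu> E e] obtain K where
      "compact K" "K \<subseteq> E" "radon_content \<nu> (E - K) \<le> ennreal e" by metis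
    moreover from this have "E - K \<in> sets borel" using E by (simp add: compact_imp_closed sets.Diff)
    ultimately show ?thesis by (auto simp: emeasure_radon_part[OF \<nu>])
  qed
  have "emeasure ?m U = (SUP C\<in>{C. compact C \<and> C \<subseteq> U}. emeasure ?m C)" if U: "open U" for U
  proof (rule antisym)
    show "emeasure ?m U \<le> (SUP C\<in>{C. compact C \<and> C \<subseteq> U}. emeasure ?m C)"
    proof (rule ennreal_le_epsilon)
      fix e :: real assume e: "0 < e"
      obtain K where K: "compact K" "K \<subseteq> U" "emeasure ?m (U - K) \<le> ennreal e"
        using approx[OF _ e, of U] U by auto
      have "emeasure ?m U = emeasure ?m (K \<union> (U - K))" using K by (simp add: Un_absorb1)
      also have "\<dots> = emeasure ?m K + emeasure ?m (U - K)"
        using K U sets by (intro plus_emeasure[symmetric]) (auto simp: compact_imp_closed)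
      also have "\<dots> \<le> (SUP C\<in>{C. compact C \<and> C \<subseteq> U}. emeasure ?m C) + ennreal e"
        using K by (intro add_mono SUP_upper) auto
      finally show "emeasure ?m U \<le> (SUP C\<in>{C. compact C \<and> C \<subseteq> U}. emeasure ?m C) + ennreal e" .
    qed
    show "(SUP C\<in>{C. compact C \<and> C \<subseteq> U}. emeasure ?m C) \<le> emeasure ?m U"
      using U sets by (intro SUP_least emeasure_mono) auto
  qed
  moreover have "emeasure ?m E = (INF U\<in>{U. open U \<and> E \<subseteq> U}. emeasure ?m U)"
    if E: "E \<in> sets borel" for E
  proof (rule antisym)
    show "emeasure ?m E \<le> (INF U\<in>{U. open U \<and> E \<subseteq> U}. emeasure ?m U)"
      using E sets by (intro INF_greatest emeasure_mono) auto
    show "(INF U\<in>{U. open U \<and> E \<subseteq> U}. emeasure ?m U) \<le> emeasure ?m E"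
    proof (rule ennreal_le_epsilon)
      fix e :: real assume e: "0 < e"
      obtain K where K: "compact K" "K \<subseteq> - E" "emeasure ?m (- E - K) \<le> ennreal e"
        using approx[OF _ e, of "- E"] E by auto
      have op: "open (- K)" using K by (simp add: compact_imp_closed open_Compl)
      have "(INF U\<in>{U. open U \<and> E \<subseteq> U}. emeasure ?m U) \<le> emeasure ?m (- K)"
        using K op by (intro INF_lower) auto
      also have "- K = E \<union> (- E - K)" using K by auto
      also have "emeasure ?m (E \<union> (- E - K)) = emeasure ?m E + emeasure ?m (- E - K)"
      proof (rule plus_emeasure[symmetric])
        have "- E - K = - E \<inter> - K" by auto
        then show "- E - K \<in> sets ?m" using E op sets by auto
      qed (use E sets in auto)
      also have "\<dots> \<le> emeasure ?m E + ennreal e" using K by (intro add_left_mono) auto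
      finally show "(INF U\<in>{U. open U \<and> E \<subseteq> U}. emeasure ?m U) \<le> emeasure ?m E + ennreal e" .
    qed
  qed
  ultimately show "regular_borel_measure ?m"
    using sets by (simp add: regular_borel_measure_def inner_compact_on_open_def outer_open_on_def)
  show "emeasure ?m A \<le> \<nu> A" if "A \<in> open_closed_sets"
    using additive_minorant_le[of A "inner_extension \<nu>"] inner_extension_le[OF \<nu> that]
      open_closed_sets_borel[OF that]
    by (simp add: emeasure_radon_part[OF \<nu>])
qed

lemma radon_content_of_measure:
  fixes m :: "'a::t2_space measure"
  assumes m: "finite_measure m" "regular_borel_measure m" and E: "E \<in> sets borel"
  shows "radon_content (restrict (emeasure m) open_closed_sets) E = emeasure m E"
proof -
  have sets: "sets m = sets borel" using m by (simp add: regular_borel_measure_def)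
  have "inner_extension (restrict (emeasure m) open_closed_sets) A = inner_extension (emeasure m) A" for A
    unfolding inner_extension_def by (intro SUP_cong) auto
  then have ie: "inner_extension (restrict (emeasure m) open_closed_sets) A = emeasure m A"
    if "A \<in> sets borel" for A
    using regular_borel_measure_inner_compact[OF m that] by simp
  have "(\<Sum>A\<in>P. inner_extension (restrict (emeasure m) open_closed_sets) A) = emeasure m E"
    if P: "P \<in> borel_partitions E" for P
  proof -
    have "(\<Sum>A\<in>P. inner_extension (restrict (emeasure m) open_closed_sets) A) = (\<Sum>A\<in>P. emeasure m A)"
      using P by (intro sum.cong ie) (auto simp: borel_partitions_def)
    also have "\<dots> = emeasure m (\<Union>A\<in>P. A)"
      using P sets by (intro sum_emeasure) (auto simp: borel_partitions_def disjoint_family_on_def disjoint_def)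
    finally show ?thesis using P by (simp add: borel_partitions_def)
  qed
  then show ?thesis
    unfolding additive_minorant_def using singleton_borel_partition[OF E]
    by (simp add: INF_constant) blast
qed

text \<open>The measure \<open>radon_part \<nu>\<close> is an admissible \<open>m\<close> in the definition of properness, and it is the
largest one: the construction is monotone and reproduces every regular measure. This criterion is
linear in \<open>\<nu>\<close>, which the definition is not.\<close>

lemma proper_iff_radon_content_UNIV:
  fixes \<nu> :: "'a::t2_space set \<Rightarrow> ennreal"
  assumes \<nu>: "\<nu> \<in> DTM"
  shows "proper_set_function \<nu> \<longleftrightarrow> radon_content \<nu> UNIV = 0"
proof
  assume "proper_set_function \<nu>"
  moreover have "radon_measure (radon_part \<nu>)"
    using radon_part_regular(1,2)[OF \<nu>] finite_measure.emeasure_finite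
    by (auto simp: radon_measure_def less_top)
  ultimately have "radon_part \<nu> = null_measure borel"
    using radon_part_regular(3)[OF \<nu>] by (auto simp: proper_set_function_def)
  then show "radon_content \<nu> UNIV = 0" using emeasure_radon_part[OF \<nu>, of UNIV] by simp
next
  assume zero: "radon_content \<nu> UNIV = 0"
  show "proper_set_function \<nu>"
    unfolding proper_set_function_def
  proof (intro allI impI)
    fix m :: "'a measure"
    assume *: "radon_measure m \<and> (\<forall>A\<in>open_closed_sets. emeasure m A \<le> \<nu> A)"
    then have reg: "regular_borel_measure m" and sets: "sets m = sets borel"
      by (auto simp: radon_measure_def regular_borel_measure_def)
    have sp: "space m = UNIV" using sets_eq_imp_space_eq[OF sets] by simp
    have "emeasure m UNIV \<le> \<nu> UNIV" using * by auto
    then have fin: "finite_measure m"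
      using DTM_finite[OF \<nu>, of UNIV] by (intro finite_measureI) (auto simp: sp)
    have "inner_extension (restrict (emeasure m) open_closed_sets) A \<le> inner_extension \<nu> A" for A
      unfolding inner_extension_def using * by (intro SUP_mono) (auto intro!: exI)
    then have "radon_content (restrict (emeasure m) open_closed_sets) UNIV \<le> radon_content \<nu> UNIV"
      unfolding additive_minorant_def by (intro INF_mono) (auto intro!: sum_mono bexI)
    then have "emeasure m UNIV = 0"
      using zero by (simp add: radon_content_of_measure[OF fin reg])
    then have "emeasure m A = 0" for A
      using emeasure_mono[of A UNIV m] sets by auto
    then show "m = null_measure borel" using sets by (intro measure_eqI) auto
  qed
qed

section \<open>Nonnegative linear combinations\<close>

text \<open>The coefficients are truncated at zero by \<open>ennreal\<close>, so a combination is always a set function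
with nonnegative values.\<close>

definition lincomb ::
    "real \<Rightarrow> ('a::topological_space set \<Rightarrow> ennreal) \<Rightarrow> real \<Rightarrow> ('a set \<Rightarrow> ennreal) \<Rightarrow> 'a set \<Rightarrow> ennreal" where
  "lincomb a \<mu> b \<nu> = (\<lambda>A\<in>open_closed_sets. ennreal a * \<mu> A + ennreal b * \<nu> A)"

lemma lincomb_apply:
  "A \<in> open_closed_sets \<Longrightarrow> lincomb a \<mu> b \<nu> A = ennreal a * \<mu> A + ennreal b * \<nu> A"
  by (simp add: lincomb_def)

lemma lincomb_commute: "lincomb a \<mu> b \<nu> = lincomb b \<nu> a \<mu>"
  by (simp add: lincomb_def add.commute)

text \<open>Compact subsets of \<open>E\<close> are directed upwards, so the supremum of the sum is the sum of the suprema.\<close>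

lemma inner_extension_lincomb:
  fixes \<mu> \<nu> :: "'a::t2_space set \<Rightarrow> ennreal"
  assumes "\<mu> \<in> DTM" "\<nu> \<in> DTM"
  shows "inner_extension (lincomb a \<mu> b \<nu>)
    = (\<lambda>E. ennreal a * inner_extension \<mu> E + ennreal b * inner_extension \<nu> E)"
proof
  fix E :: "'a set"
  let ?K = "{K. compact K \<and> K \<subseteq> E}"
  have "inner_extension (lincomb a \<mu> b \<nu>) E = (SUP K\<in>?K. ennreal a * \<mu> K + ennreal b * \<nu> K)"
    unfolding inner_extension_def by (intro SUP_cong) (auto simp: lincomb_apply)
  also have "\<dots> = (SUP K\<in>?K. ennreal a * \<mu> K) + (SUP K\<in>?K. ennreal b * \<nu> K)"
  proof (rule SUP_add_directed_ennreal)
    fix C K assume "C \<in> ?K" "K \<in> ?K"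
    then show "\<exists>L\<in>?K. ennreal a * \<mu> C + ennreal b * \<nu> K \<le> ennreal a * \<mu> L + ennreal b * \<nu> L"
      using assms by (intro bexI[of _ "C \<union> K"] add_mono mult_left_mono DTM_mono) (auto simp: compact_Un)
  qed
  finally show "inner_extension (lincomb a \<mu> b \<nu>) E
      = ennreal a * inner_extension \<mu> E + ennreal b * inner_extension \<nu> E"
    by (simp add: inner_extension_def SUP_mult_left_ennreal)
qed

lemma lincomb_DTM:
  fixes \<mu> \<nu> :: "'a::t2_space set \<Rightarrow> ennreal"
  assumes \<mu>: "\<mu> \<in> DTM" and \<nu>: "\<nu> \<in> DTM"
  shows "lincomb a \<mu> b \<nu> \<in> DTM"
proof -
  let ?l = "lincomb a \<mu> b \<nu>"
  have UN: "?l UNIV < \<infinity>"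
    using DTM_finite[OF \<mu>, of UNIV] DTM_finite[OF \<nu>, of UNIV]
    by (simp add: lincomb_apply ennreal_mult_less_top)
  have "deficient_topological_measure ?l"
    unfolding deficient_topological_measure_def
  proof (intro conjI allI impI)
    show "?l \<in> extensional open_closed_sets" by (simp add: lincomb_def)
    show "not_identically_infinite ?l"
      using UN unfolding not_identically_infinite_def by (intro bexI[of _ UNIV]) auto
    fix C K :: "'a set" assume "compact C \<and> compact K \<and> C \<inter> K = {}"
    then show "?l (C \<union> K) = ?l C + ?l K"
      by (simp add: lincomb_apply compact_Un DTM_compact_union[OF \<mu>] DTM_compact_union[OF \<nu>]
          distrib_left ac_simps)
  next
    show "inner_compact_on_open ?l"
      unfolding inner_compact_on_open_def
    proof (intro allI impI)
      fix U :: "'a set" assume U: "open U"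
      have "?l U = inner_extension ?l U"
        using U by (simp add: inner_extension_lincomb[OF \<mu> \<nu>] lincomb_apply inner_extension_open[OF \<mu>]
            inner_extension_open[OF \<nu>])
      then show "?l U = (SUP C\<in>{C. compact C \<and> C \<subseteq> U}. ?l C)" by (simp add: inner_extension_def)
    qed
  next
    show "outer_open_on {F. closed F} ?l"
      unfolding outer_open_on_def
    proof (intro ballI antisym)
      fix F :: "'a set" assume "F \<in> {F. closed F}"
      then have F: "closed F" by simp
      show "?l F \<le> (INF U\<in>{U. open U \<and> F \<subseteq> U}. ?l U)"
        using F \<mu> \<nu> by (intro INF_greatest) (auto simp: lincomb_apply intro!: add_mono mult_left_mono DTM_mono)
      have ne: "{U. open U \<and> F \<subseteq> U} \<noteq> {}" by auto
      have "(INF U\<in>{U. open U \<and> F \<subseteq> U}. ?l U)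
        \<le> (INF U\<in>{U. open U \<and> F \<subseteq> U}. ennreal a * \<mu> U) + (INF U\<in>{U. open U \<and> F \<subseteq> U}. ennreal b * \<nu> U)"
      proof (rule le_INF_plus_INF_ennreal)
        fix U V assume UV: "U \<in> {U. open U \<and> F \<subseteq> U}" "V \<in> {U. open U \<and> F \<subseteq> U}"
        then have "(INF U\<in>{U. open U \<and> F \<subseteq> U}. ?l U) \<le> ?l (U \<inter> V)" by (intro INF_lower) auto
        also have "\<dots> \<le> ennreal a * \<mu> U + ennreal b * \<nu> V"
          using UV \<mu> \<nu> by (auto simp: lincomb_apply open_Int intro!: add_mono mult_left_mono DTM_mono)
        finally show "(INF U\<in>{U. open U \<and> F \<subseteq> U}. ?l U) \<le> ennreal a * \<mu> U + ennreal b * \<nu> V" .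
      qed
      also have "\<dots> = ?l F"
        using F by (simp add: lincomb_apply DTM_closed[OF \<mu> F] DTM_closed[OF \<nu> F] INF_mult_left_ennreal[OF _ ne])
      finally show "(INF U\<in>{U. open U \<and> F \<subseteq> U}. ?l U) \<le> ?l F" .
    qed
  qed
  then show ?thesis using UN by (simp add: DTM_def)
qed

lemma radon_content_lincomb:
  fixes \<mu> \<nu> :: "'a::t2_space set \<Rightarrow> ennreal"
  assumes "\<mu> \<in> DTM" "\<nu> \<in> DTM" "E \<in> sets borel"
  shows "radon_content (lincomb a \<mu> b \<nu>) E = ennreal a * radon_content \<mu> E + ennreal b * radon_content \<nu> E"
  unfolding inner_extension_lincomb[OF assms(1,2)]
  using assms by (intro additive_minorant_lincomb inner_extension_superadditive) auto

lemma lincomb_pDTM: "\<mu> \<in> pDTM \<Longrightarrow> \<nu> \<in> pDTM \<Longrightarrow> lincomb a \<mu> b \<nu> \<in> pDTM"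
  by (auto simp: pDTM_def lincomb_DTM proper_iff_radon_content_UNIV radon_content_lincomb)

lemma lincomb_TM:
  fixes \<mu> \<nu> :: "'a::t2_space set \<Rightarrow> ennreal"
  assumes "\<mu> \<in> TM" "\<nu> \<in> TM"
  shows "lincomb a \<mu> b \<nu> \<in> TM"
proof -
  have l: "lincomb a \<mu> b \<nu> \<in> DTM" using assms TM_subset_DTM by (auto intro: lincomb_DTM)
  have "lincomb a \<mu> b \<nu> (A \<union> B) = lincomb a \<mu> b \<nu> A + lincomb a \<mu> b \<nu> B"
    if *: "compact A \<or> open A" "compact B \<or> open B" "compact (A \<union> B) \<or> open (A \<union> B)" "A \<inter> B = {}" for A B
  proof -
    have "\<mu> (A \<union> B) = \<mu> A + \<mu> B" "\<nu> (A \<union> B) = \<nu> A + \<nu> B"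
      using assms * by (auto simp: TM_def topological_measure_def)
    moreover have "A \<in> open_closed_sets" "B \<in> open_closed_sets" "A \<union> B \<in> open_closed_sets"
      using * by (auto simp: compact_in_open_closed_sets simp del: open_Un)
    ultimately show ?thesis by (simp add: lincomb_apply distrib_left ac_simps)
  qed
  then show ?thesis
    using l by (auto simp: TM_def DTM_def topological_measure_def deficient_topological_measure_def)
qed

text \<open>Both summands are superadditive. If their combination is additive and \<open>b\<close> is positive, the
inequality for \<open>\<nu>\<close> cannot be strict, because all values are finite.\<close>

lemma lincomb_TM_imp_right_TM:
  fixes \<mu> \<nu> :: "'a::t2_space set \<Rightarrow> ennreal"
  assumes l: "lincomb a \<mu> b \<nu> \<in> TM" and \<mu>: "\<mu> \<in> DTM" and \<nu>: "\<nu> \<in> DTM" and "0 < b"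
  shows "\<nu> \<in> TM"
proof -
  have "\<nu> (A \<union> B) = \<nu> A + \<nu> B"
    if *: "compact A \<or> open A" "compact B \<or> open B" "compact (A \<union> B) \<or> open (A \<union> B)" "A \<inter> B = {}" for A B
  proof (rule antisym)
    have ocs: "A \<in> open_closed_sets" "B \<in> open_closed_sets" "A \<union> B \<in> open_closed_sets"
      using * by (auto simp: compact_in_open_closed_sets simp del: open_Un)
    have "ennreal a * (\<mu> A + \<mu> B) + ennreal b * \<nu> (A \<union> B)
        \<le> ennreal a * \<mu> (A \<union> B) + ennreal b * \<nu> (A \<union> B)"
      using DTM_superadditive[OF \<mu> *] by (intro add_right_mono mult_left_mono) auto
    also have "\<dots> = lincomb a \<mu> b \<nu> (A \<union> B)" using ocs by (simp add: lincomb_apply)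
    also have "\<dots> = lincomb a \<mu> b \<nu> A + lincomb a \<mu> b \<nu> B"
      using l * by (auto simp: TM_def topological_measure_def)
    also have "\<dots> = ennreal a * (\<mu> A + \<mu> B) + ennreal b * (\<nu> A + \<nu> B)"
      using ocs by (simp add: lincomb_apply distrib_left ac_simps)
    finally have "ennreal b * \<nu> (A \<union> B) \<le> ennreal b * (\<nu> A + \<nu> B)"
      using DTM_finite[OF \<mu> ocs(1)] DTM_finite[OF \<mu> ocs(2)]
      by (simp add: ennreal_add_left_cancel_le ennreal_mult_eq_top_iff less_top[symmetric])
    then show "\<nu> (A \<union> B) \<le> \<nu> A + \<nu> B"
      using \<open>0 < b\<close> by (simp add: ennreal_mult_le_mult_iff)
    show "\<nu> A + \<nu> B \<le> \<nu> (A \<union> B)" by (rule DTM_superadditive[OF \<nu> *])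
  qed
  then show ?thesis
    using \<nu> by (auto simp: TM_def DTM_def topological_measure_def deficient_topological_measure_def)
qed

section \<open>Decomposition into a measure and a proper part\<close>

text \<open>Subtracting the largest measure below \<open>\<nu>\<close> leaves a deficient topological measure. The only
delicate point is that the difference is monotone: between \<open>A\<close> and an open \<open>U\<close> the measure
\<open>\<mu>\<close> gains what it has on compact subsets of \<open>U - A\<close>, and there \<open>\<nu>\<close> gains at least as much by
superadditivity. Regularity then passes to the difference. It is proper because
\<open>radon_content\<close> is linear and takes the same value on \<open>\<mu>\<close> as on \<open>\<nu>\<close>.\<close>

lemma DTM_decomposition:
  fixes \<nu> :: "'a::t2_space set \<Rightarrow> ennreal"
  assumes \<nu>: "\<nu> \<in> DTM"
  obtains \<mu> \<nu>' where "\<mu> \<in> FBM" "\<nu>' \<in> pDTM" "\<nu> = lincomb 1 \<mu> 1 \<nu>'"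
proof -
  let ?m = "radon_part \<nu>"
  define \<mu> where "\<mu> = restrict (emeasure ?m) open_closed_sets"
  define \<nu>' where "\<nu>' = (\<lambda>A\<in>open_closed_sets. \<nu> A - \<mu> A)"
  note m = radon_part_regular[OF \<nu>]
  have FBM: "\<mu> \<in> FBM" using m by (auto simp: FBM_def \<mu>_def)
  then have \<mu>: "\<mu> \<in> DTM" using FBM_subset_TM TM_subset_DTM by auto
  have sets: "sets ?m = sets borel" using m by (simp add: regular_borel_measure_def)
  have meas: "A \<in> sets ?m" if "A \<in> open_closed_sets" for A
    using open_closed_sets_borel[OF that] sets by simp
  have \<mu>_eq: "\<mu> A = emeasure ?m A" if "A \<in> open_closed_sets" for A using that by (simp add: \<mu>_def)
  have split: "\<nu> A = \<mu> A + \<nu>' A" if "A \<in> open_closed_sets" for A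
    using that m(3)[OF that] by (simp add: \<nu>'_def \<mu>_eq add_diff_inverse_ennreal)
  have fin: "\<mu> A \<noteq> top" if "A \<in> open_closed_sets" for A
    using DTM_finite[OF \<mu> that] by auto
  have mono: "\<nu>' A \<le> \<nu>' U" if A: "A \<in> open_closed_sets" and U: "open U" and "A \<subseteq> U" for A U
  proof -
    have UA: "U - A \<in> sets borel" using U open_closed_sets_borel[OF A] by auto
    have "\<mu> U = emeasure ?m (A \<union> (U - A))" using U \<open>A \<subseteq> U\<close> by (simp add: \<mu>_eq Un_absorb1)
    also have "\<dots> = emeasure ?m (U - A) + \<mu> A"
      using A UA meas sets by (subst plus_emeasure[symmetric]) (auto simp: \<mu>_eq add.commute)
    finally have "\<mu> U + \<nu>' A = emeasure ?m (U - A) + \<nu> A" by (simp add: split[OF A] add.assoc)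
    also have "\<dots> = (SUP C\<in>{C. compact C \<and> C \<subseteq> U - A}. emeasure ?m C + \<nu> A)"
      unfolding regular_borel_measure_inner_compact[OF m(1,2) UA, symmetric] inner_extension_def
      by (rule ennreal_SUP_add_left[symmetric]) (auto intro: exI[of _ "{}"])
    also have "\<dots> \<le> \<nu> U"
    proof (rule SUP_least)
      fix C assume C: "C \<in> {C. compact C \<and> C \<subseteq> U - A}"
      then have "emeasure ?m C + \<nu> A \<le> \<nu> A + \<nu> C"
        using m(3)[of C] by (simp add: add.commute add_left_mono)
      also have "\<dots> \<le> \<nu> U" using C A U \<open>A \<subseteq> U\<close> by (intro DTM_superadditive_below_open[OF \<nu>]) auto
      finally show "emeasure ?m C + \<nu> A \<le> \<nu> U" .
    qed
    also have "\<dots> = \<mu> U + \<nu>' U" using U by (simp add: split)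
    finally show ?thesis using fin[of U] U by (simp add: ennreal_add_left_cancel_le)
  qed
  have UN: "\<nu>' UNIV < \<infinity>"
    using DTM_finite[OF \<nu>, of UNIV] split[of UNIV] by auto
  have "deficient_topological_measure \<nu>'"
    unfolding deficient_topological_measure_def
  proof (intro conjI allI impI)
    show "\<nu>' \<in> extensional open_closed_sets" by (simp add: \<nu>'_def)
    show "not_identically_infinite \<nu>'"
      using UN unfolding not_identically_infinite_def by (intro bexI[of _ UNIV]) auto
    fix C K :: "'a set" assume CK: "compact C \<and> compact K \<and> C \<inter> K = {}"
    then have "(\<mu> C + \<mu> K) + \<nu>' (C \<union> K) = \<nu> (C \<union> K)"
      by (simp add: split compact_Un DTM_compact_union[OF \<mu>])
    also have "\<dots> = (\<mu> C + \<mu> K) + (\<nu>' C + \<nu>' K)"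
      using CK by (simp add: DTM_compact_union[OF \<nu>] split ac_simps)
    finally show "\<nu>' (C \<union> K) = \<nu>' C + \<nu>' K"
      using CK fin[of C] fin[of K] by (simp add: ennreal_add_left_cancel)
  next
    show "inner_compact_on_open \<nu>'"
      unfolding inner_compact_on_open_def
    proof (intro allI impI antisym)
      fix U :: "'a set" assume U: "open U"
      let ?S = "SUP C\<in>{C. compact C \<and> C \<subseteq> U}. \<nu>' C"
      show "?S \<le> \<nu>' U" using U by (intro SUP_least mono) auto
      have "\<mu> U + \<nu>' U = \<nu> U" using U by (simp add: split)
      also have "\<dots> \<le> \<mu> U + ?S"
        unfolding DTM_open[OF \<nu> U]
      proof (rule SUP_least)
        fix C assume C: "C \<in> {C. compact C \<and> C \<subseteq> U}"
        then have "\<nu>' C \<le> ?S" by (intro SUP_upper)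
        moreover have "\<mu> C \<le> \<mu> U" using C U by (intro DTM_mono[OF \<mu>]) auto
        ultimately show "\<nu> C \<le> \<mu> U + ?S" using C by (simp add: split add_mono)
      qed
      finally show "\<nu>' U \<le> ?S" using fin[of U] U by (simp add: ennreal_add_left_cancel_le)
    qed
  next
    show "outer_open_on {F. closed F} \<nu>'"
      unfolding outer_open_on_def
    proof (intro ballI antisym)
      fix F :: "'a set" assume "F \<in> {F. closed F}"
      then have F: "closed F" by simp
      let ?I = "INF U\<in>{U. open U \<and> F \<subseteq> U}. \<nu>' U"
      show "\<nu>' F \<le> ?I" using F by (intro INF_greatest mono) auto
      have "\<mu> F + ?I \<le> \<nu> F"
        unfolding DTM_closed[OF \<nu> F]
      proof (rule INF_greatest)
        fix U assume U: "U \<in> {U. open U \<and> F \<subseteq> U}"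
        then have "?I \<le> \<nu>' U" by (intro INF_lower)
        moreover have "\<mu> F \<le> \<mu> U" using F U by (intro DTM_mono[OF \<mu>]) auto
        ultimately show "\<mu> F + ?I \<le> \<nu> U" using U by (simp add: split add_mono)
      qed
      also have "\<nu> F = \<mu> F + \<nu>' F" using F by (simp add: split)
      finally show "?I \<le> \<nu>' F" using fin[of F] F by (simp add: ennreal_add_left_cancel_le)
    qed
  qed
  then have \<nu>': "\<nu>' \<in> DTM" using UN by (simp add: DTM_def)
  have eq: "\<nu> = lincomb 1 \<mu> 1 \<nu>'"
  proof
    fix A
    show "\<nu> A = lincomb 1 \<mu> 1 \<nu>' A"
      using \<nu> split[of A]
      by (cases "A \<in> open_closed_sets")
         (auto simp: lincomb_def DTM_def deficient_topological_measure_def extensional_def)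
  qed
  have "radon_content \<nu> UNIV = radon_content \<mu> UNIV + radon_content \<nu>' UNIV"
    using radon_content_lincomb[OF \<mu> \<nu>', of UNIV 1 1] eq by simp
  moreover have "radon_content \<mu> UNIV = radon_content \<nu> UNIV"
    using radon_content_of_measure[OF m(1,2), of UNIV] by (simp add: \<mu>_def emeasure_radon_part[OF \<nu>])
  ultimately have "radon_content \<nu>' UNIV = 0"
    using radon_content_finite[OF \<nu>, of UNIV]
    by (metis add.right_neutral ennreal_add_left_cancel less_top sets.top space_borel infinity_ennreal_def less_irrefl)
  then have "\<nu>' \<in> pDTM" using \<nu>' by (simp add: pDTM_def proper_iff_radon_content_UNIV)
  with FBM eq that show ?thesis by blast
qed

section \<open>The integral\<close>

lemma open_superlevel:
  fixes f :: "'a::t2_space \<Rightarrow> real"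
  shows "f \<in> C0_nonneg \<Longrightarrow> open (f -` {t<..})"
  by (auto simp: C0_nonneg_def intro: open_vimage)

lemma C0_nonneg_bounded:
  fixes f :: "'a::t2_space \<Rightarrow> real"
  assumes "f \<in> C0_nonneg"
  shows "bdd_above (range f)"
proof -
  obtain K where K: "compact K" "\<And>x. x \<notin> K \<Longrightarrow> \<bar>f x\<bar> < 1"
    using assms zero_less_one[where 'a = real] unfolding C0_nonneg_def by blast
  have "continuous_on K f" using assms by (auto simp: C0_nonneg_def intro: continuous_on_subset)
  then have "bounded (f ` K)" using K(1) by (intro compact_imp_bounded compact_continuous_image)
  then obtain B where B: "\<And>x. x \<in> K \<Longrightarrow> \<bar>f x\<bar> \<le> B" by (auto simp: bounded_iff)
  have "f x \<le> max B 1" for x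
    using B[of x] K(2)[of x] by (cases "x \<in> K") (auto simp: max_def)
  then show ?thesis by (intro bdd_aboveI[of _ "max B 1"]) auto
qed

lemma C0_nonneg_le_Sup:
  fixes f :: "'a::t2_space \<Rightarrow> real"
  shows "f \<in> C0_nonneg \<Longrightarrow> f x \<le> (SUP x. f x)"
  by (rule cSUP_upper[OF UNIV_I C0_nonneg_bounded])

lemma C0_nonneg_measurable:
  fixes f :: "'a::t2_space \<Rightarrow> real"
  assumes "f \<in> C0_nonneg" "sets m = sets borel"
  shows "f \<in> borel_measurable m"
proof -
  have "f \<in> borel_measurable borel"
    using assms(1) by (intro borel_measurable_continuous_onI) (simp add: C0_nonneg_def)
  then show ?thesis by (simp only: measurable_cong_sets[OF assms(2) refl])
qed

lemma superlevel_integrable: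
  assumes \<nu>: "\<nu> \<in> DTM" and f: "f \<in> C0_nonneg"
  shows "(\<lambda>t. enn2real (\<nu> (f -` {t<..}))) integrable_on {a..b}"
proof -
  have "mono_on {a..b} (\<lambda>t. - enn2real (\<nu> (f -` {t<..})))"
  proof (rule mono_onI)
    fix s t :: real assume "s \<le> t"
    then have "\<nu> (f -` {t<..}) \<le> \<nu> (f -` {s<..})"
      using open_superlevel[OF f] by (intro DTM_mono[OF \<nu>]) auto
    then show "- enn2real (\<nu> (f -` {s<..})) \<le> - enn2real (\<nu> (f -` {t<..}))"
      using DTM_finite[OF \<nu>, of "f -` {s<..}"] open_superlevel[OF f] by (simp add: enn2real_mono)
  qed
  from integrable_neg[OF integrable_on_mono_on[OF this]] show ?thesis by simp
qed

lemma dtm_integral_lincomb: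
  assumes \<mu>: "\<mu> \<in> DTM" and \<nu>: "\<nu> \<in> DTM" and f: "f \<in> C0_nonneg" and ab: "0 \<le> a" "0 \<le> b"
  shows "dtm_integral (lincomb a \<mu> b \<nu>) f = a * dtm_integral \<mu> f + b * dtm_integral \<nu> f"
proof -
  let ?S = "SUP x. f x"
  have "enn2real (lincomb a \<mu> b \<nu> (f -` {t<..}))
      = a * enn2real (\<mu> (f -` {t<..})) + b * enn2real (\<nu> (f -` {t<..}))" for t
    using DTM_finite[OF \<mu>, of "f -` {t<..}"] DTM_finite[OF \<nu>, of "f -` {t<..}"] open_superlevel[OF f] ab
    by (simp add: lincomb_apply enn2real_plus enn2real_mult ennreal_mult_less_top)
  moreover have "((\<lambda>t. a * enn2real (\<mu> (f -` {t<..})) + b * enn2real (\<nu> (f -` {t<..})))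
      has_integral a * dtm_integral \<mu> f + b * dtm_integral \<nu> f) {0..?S}"
    unfolding dtm_integral_def
    by (intro has_integral_add has_integral_mult_right integrable_integral superlevel_integrable \<mu> \<nu> f)
  ultimately show ?thesis
    unfolding dtm_integral_def[of "lincomb a \<mu> b \<nu>"] by (simp add: integral_unique)
qed

text \<open>The layer cake formula: by Tonelli's theorem the area below the graph of \<open>f\<close> can be measured by
horizontal or by vertical sections.\<close>

lemma dtm_integral_eq_lebesgue_integral:
  fixes m :: "'a::t2_space measure"
  assumes "finite_measure m" and sets: "sets m = sets borel"
    and \<nu>: "\<And>U. open U \<Longrightarrow> \<nu> U = emeasure m U" and f: "f \<in> C0_nonneg"
  shows "dtm_integral \<nu> f = (LINT x|m. f x)"
proof -
  interpret finite_measure m by fact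
  interpret pair_sigma_finite lborel m ..
  let ?S = "SUP x. f x"
  have fS: "f x \<le> ?S" and f0: "0 \<le> f x" for x
    using f C0_nonneg_le_Sup by (auto simp: C0_nonneg_def)
  have [measurable]: "f \<in> borel_measurable m"
    by (rule C0_nonneg_measurable[OF f sets])
  have sp: "space m = UNIV" using sets_eq_imp_space_eq[OF sets] by simp
  have int: "integrable m f"
    using fS f0 by (intro integrable_const_bound[of _ ?S]) auto
  define h where "h t = (if 0 \<le> t then measure m (f -` {t<..}) else 0)" for t
  have lev: "f -` {t<..} \<in> sets m" for t using open_superlevel[OF f] sets by simp
  have "mono (\<lambda>t. - measure m (f -` {t<..}))"
    using lev by (intro monoI) (auto intro!: finite_measure_mono)
  then have "(\<lambda>t. - measure m (f -` {t<..})) \<in> borel_measurable borel" by (rule borel_measurable_mono)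
  then have hm: "h \<in> borel_measurable borel"
    unfolding h_def borel_measurable_uminus_eq by measurable
  have "(\<integral>\<^sup>+t. ennreal (h t) \<partial>lborel)
      = (\<integral>\<^sup>+t. (\<integral>\<^sup>+x. (if 0 \<le> t \<and> t < f x then 1 else 0) \<partial>m) \<partial>lborel)"
  proof (rule nn_integral_cong)
    fix t :: real
    have "(\<integral>\<^sup>+x. (if 0 \<le> t \<and> t < f x then 1 else 0) \<partial>m)
        = (\<integral>\<^sup>+x. (if 0 \<le> t then indicator (f -` {t<..}) x else 0) \<partial>m)"
      by (intro nn_integral_cong) (auto simp: indicator_def)
    also have "\<dots> = ennreal (h t)" using lev[of t] by (simp add: h_def emeasure_eq_measure)
    finally show "ennreal (h t) = (\<integral>\<^sup>+x. (if 0 \<le> t \<and> t < f x then 1 else 0) \<partial>m)" ..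
  qed
  also have "\<dots> = (\<integral>\<^sup>+x. (\<integral>\<^sup>+t. (if 0 \<le> t \<and> t < f x then 1 else 0) \<partial>lborel) \<partial>m)"
    by (rule Fubini'[symmetric]) measurable
  also have "\<dots> = (\<integral>\<^sup>+x. ennreal (f x) \<partial>m)"
  proof (rule nn_integral_cong)
    fix x
    have "(\<integral>\<^sup>+t. (if 0 \<le> t \<and> t < f x then 1 else 0) \<partial>lborel) = (\<integral>\<^sup>+t. indicator {0..<f x} t \<partial>lborel)"
      by (intro nn_integral_cong) (auto simp: indicator_def)
    then show "(\<integral>\<^sup>+t. (if 0 \<le> t \<and> t < f x then 1 else 0) \<partial>lborel) = ennreal (f x)"
      using f0[of x] by simp
  qed
  also have "\<dots> = ennreal (LINT x|m. f x)" using int f0 by (intro nn_integral_eq_integral) auto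
  finally have "(h has_integral (LINT x|m. f x)) UNIV"
    using f0 by (intro nn_integral_has_integral[OF hm]) (auto simp: h_def intro!: Bochner_Integration.integral_nonneg)
  then have "integral UNIV h = (LINT x|m. f x)" by (rule integral_unique)
  moreover have "h = (\<lambda>t. if t \<in> {0..?S} then enn2real (\<nu> (f -` {t<..})) else 0)"
  proof
    fix t
    have "f -` {t<..} = {}" if "?S < t" using order.strict_trans1[OF fS that] by (auto dest: less_asym)
    then show "h t = (if t \<in> {0..?S} then enn2real (\<nu> (f -` {t<..})) else 0)"
      by (auto simp: h_def \<nu>[OF open_superlevel[OF f]] measure_def)
  qed
  ultimately show ?thesis
    unfolding dtm_integral_def by (simp only: integral_restrict_UNIV)
qed

lemma dtm_integral_point_mass:
  fixes a :: "'a::t2_space"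
  assumes f: "f \<in> C0_nonneg"
  shows "dtm_integral (point_mass a) f = f a"
proof -
  let ?S = "SUP x. f x"
  have fa: "0 \<le> f a" "f a \<le> ?S" using f C0_nonneg_le_Sup[OF f] by (auto simp: C0_nonneg_def)
  have "((\<lambda>t. 1::real) has_integral f a) {0..f a}" using has_integral_const_real[of "1::real" 0 "f a"] fa by simp
  then have "((\<lambda>t. if t \<in> {0..f a} then 1 else 0 :: real) has_integral f a) {0..?S}"
    using fa by (subst has_integral_restrict) auto
  then have "((\<lambda>t. enn2real (point_mass a (f -` {t<..}))) has_integral f a) {0..?S}"
    by (rule has_integral_spike_finite[of "{f a}", rotated 2])
       (auto simp: point_mass_def open_superlevel[OF f])
  then show ?thesis unfolding dtm_integral_def by (rule integral_unique)
qed

section \<open>The weak closure\<close>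

text \<open>The sets of \<open>\<mu>\<close> whose integrals against finitely many \<open>f\<close> differ from those of \<open>\<nu>\<close> by less
than \<open>e\<close> form a neighbourhood base at \<open>\<nu>\<close>.\<close>

lemma in_weak_closure_iff:
  fixes Y :: "('a::t2_space set \<Rightarrow> ennreal) set"
  assumes "Y \<subseteq> DTM"
  shows "\<nu> \<in> weak_topology closure_of Y \<longleftrightarrow> \<nu> \<in> DTM \<and>
    (\<forall>F e. finite F \<longrightarrow> F \<subseteq> C0_nonneg \<longrightarrow> 0 < e \<longrightarrow>
      (\<exists>\<mu>\<in>Y. \<forall>f\<in>F. \<bar>dtm_integral \<mu> f - dtm_integral \<nu> f\<bar> < e))"
    (is "_ \<longleftrightarrow> _ \<and> ?approx")
proof (intro iffI conjI allI impI)
  let ?B = "{{\<mu>\<in>DTM. dtm_integral \<mu> f \<in> V} | f V. f \<in> (C0_nonneg :: ('a \<Rightarrow> real) set) \<and> open V}"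
  assume cl: "\<nu> \<in> weak_topology closure_of Y"
  then show \<nu>: "\<nu> \<in> DTM" using topspace_weak_topology by (auto simp: in_closure_of)
  fix F :: "('a \<Rightarrow> real) set" and e :: real
  assume F: "finite F" "F \<subseteq> C0_nonneg" and e: "0 < e"
  let ?N = "\<lambda>f. {\<mu>\<in>DTM. dtm_integral \<mu> f \<in> ball (dtm_integral \<nu> f) e}"
  have "openin weak_topology ((\<Inter>f\<in>F. ?N f) \<inter> topspace weak_topology)"
  proof (rule openin_INT[OF F(1)])
    fix f assume "f \<in> F"
    then have "?N f \<in> ?B" using F(2) open_ball by blast
    then show "openin weak_topology (?N f)"
      unfolding weak_topology_def by (rule topology_generated_by_Basis)
  qed
  moreover have "\<nu> \<in> (\<Inter>f\<in>F. ?N f) \<inter> topspace weak_topology"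
    using \<nu> e by (auto simp: topspace_weak_topology)
  ultimately obtain \<mu> where "\<mu> \<in> Y" "\<mu> \<in> (\<Inter>f\<in>F. ?N f)"
    using cl unfolding in_closure_of by blast
  then show "\<exists>\<mu>\<in>Y. \<forall>f\<in>F. \<bar>dtm_integral \<mu> f - dtm_integral \<nu> f\<bar> < e"
    by (intro bexI[of _ \<mu>]) (auto simp: dist_real_def abs_minus_commute)
next
  let ?B = "{{\<mu>\<in>DTM. dtm_integral \<mu> f \<in> V} | f V. f \<in> (C0_nonneg :: ('a \<Rightarrow> real) set) \<and> open V}"
  assume \<nu>: "\<nu> \<in> DTM \<and> ?approx"
  have nbhd: "\<nu> \<in> T \<longrightarrow> (\<exists>F e. finite F \<and> F \<subseteq> C0_nonneg \<and> 0 < e \<and>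
      {\<mu>\<in>DTM. \<forall>f\<in>F. \<bar>dtm_integral \<mu> f - dtm_integral \<nu> f\<bar> < e} \<subseteq> T)"
    if "generate_topology_on ?B T" for T
    using that
  proof (induction rule: generate_topology_on.induct)
    case Empty
    then show ?case by simp
  next
    case (Int S T)
    show ?case
    proof
      assume "\<nu> \<in> S \<inter> T"
      then obtain F e G d where
        "finite F" "F \<subseteq> C0_nonneg" "0 < e"
        "{\<mu>\<in>DTM. \<forall>f\<in>F. \<bar>dtm_integral \<mu> f - dtm_integral \<nu> f\<bar> < e} \<subseteq> S"
        "finite G" "G \<subseteq> C0_nonneg" "0 < d"
        "{\<mu>\<in>DTM. \<forall>f\<in>G. \<bar>dtm_integral \<mu> f - dtm_integral \<nu> f\<bar> < d} \<subseteq> T"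
        using Int.IH by auto
      then show "\<exists>F e. finite F \<and> F \<subseteq> C0_nonneg \<and> 0 < e \<and>
          {\<mu>\<in>DTM. \<forall>f\<in>F. \<bar>dtm_integral \<mu> f - dtm_integral \<nu> f\<bar> < e} \<subseteq> S \<inter> T"
        by (intro exI[of _ "F \<union> G"] exI[of _ "min e d"]) auto
    qed
  next
    case (UN \<K>)
    show ?case
    proof
      assume "\<nu> \<in> \<Union>\<K>"
      then obtain k where "k \<in> \<K>" "\<nu> \<in> k" by blast
      with UN.IH[of k] show "\<exists>F e. finite F \<and> F \<subseteq> C0_nonneg \<and> 0 < e \<and>
          {\<mu>\<in>DTM. \<forall>f\<in>F. \<bar>dtm_integral \<mu> f - dtm_integral \<nu> f\<bar> < e} \<subseteq> \<Union>\<K>"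
        by (meson Union_upper order_trans)
    qed
  next
    case (Basis T)
    then obtain f V where T: "T = {\<mu>\<in>DTM. dtm_integral \<mu> f \<in> V}" and f: "f \<in> C0_nonneg" and V: "open V"
      by blast
    show ?case
    proof
      assume "\<nu> \<in> T"
      then obtain e where e: "0 < e" "ball (dtm_integral \<nu> f) e \<subseteq> V"
        using V T open_contains_ball by blast
      have "{\<mu>\<in>DTM. \<forall>f\<in>{f}. \<bar>dtm_integral \<mu> f - dtm_integral \<nu> f\<bar> < e} \<subseteq> T"
        using e(2) T by (auto simp: dist_real_def abs_minus_commute subset_iff)
      then show "\<exists>F e. finite F \<and> F \<subseteq> C0_nonneg \<and> 0 < e \<and>
          {\<mu>\<in>DTM. \<forall>f\<in>F. \<bar>dtm_integral \<mu> f - dtm_integral \<nu> f\<bar> < e} \<subseteq> T"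
        using e(1) f by (intro exI[of _ "{f}"] exI[of _ e]) auto
    qed
  qed
  show "\<nu> \<in> weak_topology closure_of Y"
    unfolding in_closure_of
  proof (intro conjI allI impI)
    show "\<nu> \<in> topspace weak_topology" using \<nu> by (simp add: topspace_weak_topology)
    fix T assume T: "\<nu> \<in> T \<and> openin weak_topology T"
    then have "generate_topology_on ?B T"
      by (auto simp: weak_topology_def intro: openin_topology_generated_by)
    from nbhd[OF this] T obtain F e where *: "finite F" "F \<subseteq> C0_nonneg" "0 < e"
      "{\<mu>\<in>DTM. \<forall>f\<in>F. \<bar>dtm_integral \<mu> f - dtm_integral \<nu> f\<bar> < e} \<subseteq> T" by blast
    then obtain \<mu> where "\<mu> \<in> Y" "\<forall>f\<in>F. \<bar>dtm_integral \<mu> f - dtm_integral \<nu> f\<bar> < e"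
      using \<nu> by blast
    then show "\<exists>y. y \<in> Y \<and> y \<in> T" using * assms by blast
  qed
qed

lemma weak_closure_approx:
  assumes "Y \<subseteq> DTM" "\<nu> \<in> weak_topology closure_of Y" "finite F" "F \<subseteq> C0_nonneg" "0 < e"
  obtains \<mu> where "\<mu> \<in> Y" "\<And>f. f \<in> F \<Longrightarrow> \<bar>dtm_integral \<mu> f - dtm_integral \<nu> f\<bar> < e"
proof -
  have "\<exists>\<mu>\<in>Y. \<forall>f\<in>F. \<bar>dtm_integral \<mu> f - dtm_integral \<nu> f\<bar> < e"
    using assms(2)[unfolded in_weak_closure_iff[OF assms(1)], THEN conjunct2, rule_format, OF assms(3-5)]
    by simp
  then show thesis using that by blast
qed

text \<open>Gives a coefficient \<open>\<eta>\<close> so small that \<open>\<eta>\<close> times a set function is weakly negligible for the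
finitely many test functions in \<open>F\<close>.\<close>

lemma finite_bound_weighted:
  fixes u :: "'b \<Rightarrow> real"
  assumes "finite F" "0 < e"
  obtains \<eta> where "0 < \<eta>" "\<And>f. f \<in> F \<Longrightarrow> \<eta> * \<bar>u f\<bar> < e"
proof
  let ?M = "\<Sum>f\<in>F. \<bar>u f\<bar>"
  have M: "0 \<le> ?M" by (simp add: sum_nonneg)
  show "0 < e / (?M + 1)" using M assms(2) by (intro divide_pos_pos) linarith+
  fix f assume "f \<in> F"
  then have "\<bar>u f\<bar> \<le> ?M" using assms(1) by (intro member_le_sum) auto
  then have "e * \<bar>u f\<bar> < e * (?M + 1)" using assms(2) by simp
  moreover have "0 < ?M + 1" using M by linarith
  ultimately show "e / (?M + 1) * \<bar>u f\<bar> < e" by (simp add: pos_divide_less_eq)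
qed

text \<open>Translation by \<open>\<nu>\<close> shifts all integrals by a constant, so it preserves weak approximation.\<close>

lemma closure_add:
  assumes Y: "Y \<subseteq> DTM" and \<mu>: "\<mu> \<in> weak_topology closure_of Y" and \<nu>: "\<nu> \<in> DTM"
    and add: "\<And>y. y \<in> Y \<Longrightarrow> lincomb 1 y 1 \<nu> \<in> Y"
  shows "lincomb 1 \<mu> 1 \<nu> \<in> weak_topology closure_of Y"
  unfolding in_weak_closure_iff[OF Y]
proof (intro conjI allI impI)
  have \<mu>D: "\<mu> \<in> DTM" using \<mu> by (simp add: in_weak_closure_iff[OF Y])
  then show "lincomb 1 \<mu> 1 \<nu> \<in> DTM" using \<nu> by (rule lincomb_DTM)
  fix F :: "('a \<Rightarrow> real) set" and e :: real
  assume F: "finite F" "F \<subseteq> C0_nonneg" and e: "0 < e"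
  obtain y where y: "y \<in> Y" "\<And>f. f \<in> F \<Longrightarrow> \<bar>dtm_integral y f - dtm_integral \<mu> f\<bar> < e"
    using weak_closure_approx[OF Y \<mu> F e] by metis
  have "\<bar>dtm_integral (lincomb 1 y 1 \<nu>) f - dtm_integral (lincomb 1 \<mu> 1 \<nu>) f\<bar> < e" if "f \<in> F" for f
  proof -
    have "y \<in> DTM" "f \<in> C0_nonneg" using y(1) Y F(2) that by blast+
    then show ?thesis using y(2)[OF that] by (simp add: dtm_integral_lincomb \<mu>D \<nu>)
  qed
  then show "\<exists>y\<in>Y. \<forall>f\<in>F. \<bar>dtm_integral y f - dtm_integral (lincomb 1 \<mu> 1 \<nu>) f\<bar> < e"
    using add[OF y(1)] by blast
qed

lemma closure_perturb:
  assumes Y: "Y \<subseteq> DTM" and \<mu>: "\<mu> \<in> DTM" and \<nu>: "\<nu> \<in> DTM"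
    and add: "\<And>\<eta>. 0 < \<eta> \<Longrightarrow> lincomb 1 \<mu> \<eta> \<nu> \<in> Y"
  shows "\<mu> \<in> weak_topology closure_of Y"
  unfolding in_weak_closure_iff[OF Y]
proof (intro conjI allI impI \<mu>)
  fix F :: "('a \<Rightarrow> real) set" and e :: real
  assume F: "finite F" "F \<subseteq> C0_nonneg" and e: "0 < e"
  obtain \<eta> where \<eta>: "0 < \<eta>" "\<And>f. f \<in> F \<Longrightarrow> \<eta> * \<bar>dtm_integral \<nu> f\<bar> < e"
    using finite_bound_weighted[OF F(1) e] by metis
  have "\<bar>dtm_integral (lincomb 1 \<mu> \<eta> \<nu>) f - dtm_integral \<mu> f\<bar> < e" if "f \<in> F" for f
    using that \<eta> F \<mu> \<nu> by (subst dtm_integral_lincomb) (auto simp: abs_mult)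
  then show "\<exists>y\<in>Y. \<forall>f\<in>F. \<bar>dtm_integral y f - dtm_integral \<mu> f\<bar> < e"
    using add[OF \<eta>(1)] by blast
qed

section \<open>Approximation by combinations of point masses\<close>

text \<open>The cone \<open>Y\<close> is closed under combinations only when the first coefficient is strictly positive,
as is the case for the set functions that are not topological measures. The induction therefore starts
from a small positive multiple of an element of \<open>Y\<close> instead of from zero.\<close>

lemma approximate_combination_of_point_masses:
  fixes Y :: "('a::t2_space set \<Rightarrow> ennreal) set"
  assumes Y: "Y \<subseteq> DTM"
    and comb: "\<And>y z a b. y \<in> Y \<Longrightarrow> z \<in> Y \<Longrightarrow> 0 < a \<Longrightarrow> 0 \<le> b \<Longrightarrow> lincomb a y b z \<in> Y"
    and dense: "dense_in Y (range point_mass)"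
    and F: "finite F" "F \<subseteq> C0_nonneg"
    and J: "finite J" "\<And>x. x \<in> J \<Longrightarrow> 0 \<le> c x" and "0 < e"
  shows "\<exists>y\<in>Y. \<forall>f\<in>F. \<bar>dtm_integral y f - (\<Sum>x\<in>J. c x * f x)\<bar> < e"
  using J \<open>0 < e\<close>
proof (induction J arbitrary: e rule: finite_induct)
  have near: "\<exists>z\<in>Y. \<forall>f\<in>F. \<bar>dtm_integral z f - f x\<bar> < d" if "0 < d" for x d
  proof -
    have "point_mass x \<in> weak_topology closure_of Y" using dense by (auto simp: dense_in_def)
    then obtain z where z: "z \<in> Y"
      "\<And>f. f \<in> F \<Longrightarrow> \<bar>dtm_integral z f - dtm_integral (point_mass x) f\<bar> < d"
      using weak_closure_approx[OF Y _ F \<open>0 < d\<close>] by metis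
    have "\<bar>dtm_integral z f - f x\<bar> < d" if "f \<in> F" for f
    proof -
      have "f \<in> C0_nonneg" using that F(2) by blast
      then show ?thesis using z(2)[OF that] by (simp only: dtm_integral_point_mass)
    qed
    then show ?thesis using z(1) by blast
  qed
  {
    case empty
    obtain z where z: "z \<in> Y" using near[of 1] by auto
    obtain \<eta> where \<eta>: "0 < \<eta>" "\<And>f. f \<in> F \<Longrightarrow> \<eta> * \<bar>dtm_integral z f\<bar> < e"
      using finite_bound_weighted[OF F(1) \<open>0 < e\<close>] by metis
    have "\<bar>dtm_integral (lincomb \<eta> z 0 z) f\<bar> < e" if "f \<in> F" for f
      using \<eta> that z Y F by (subst dtm_integral_lincomb) (auto simp: abs_mult)
    moreover have "lincomb \<eta> z 0 z \<in> Y" using comb[OF z z \<eta>(1)] by simp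
    ultimately show ?case by (intro bexI[of _ "lincomb \<eta> z 0 z"]) auto
  next
    case (insert x J)
    have c: "0 \<le> c x" using insert.prems by auto
    obtain y where y: "y \<in> Y" "\<And>f. f \<in> F \<Longrightarrow> \<bar>dtm_integral y f - (\<Sum>x\<in>J. c x * f x)\<bar> < e/2"
      using insert.IH[of "e/2"] insert.prems by auto
    have "0 < c x + 1" using c by linarith
    then have d: "0 < e / (2 * (c x + 1))" using insert.prems(2) by (intro divide_pos_pos mult_pos_pos) auto
    obtain z where z: "z \<in> Y" "\<And>f. f \<in> F \<Longrightarrow> \<bar>dtm_integral z f - f x\<bar> < e / (2 * (c x + 1))"
      using near[OF d, of x] by auto
    have "\<bar>dtm_integral (lincomb 1 y (c x) z) f - (\<Sum>x\<in>insert x J. c x * f x)\<bar> < e" if f: "f \<in> F" for f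
    proof -
      have "c x * \<bar>dtm_integral z f - f x\<bar> \<le> c x * (e / (2 * (c x + 1)))"
        using z(2)[OF f] c by (intro mult_left_mono) auto
      also have "\<dots> \<le> e/2" using insert.prems(2) c by (simp add: field_simps)
      finally have "\<bar>c x * dtm_integral z f - c x * f x\<bar> \<le> e/2"
        using c by (simp add: abs_mult flip: right_diff_distrib)
      moreover have "dtm_integral (lincomb 1 y (c x) z) f = dtm_integral y f + c x * dtm_integral z f"
        using f y z Y F c by (subst dtm_integral_lincomb) auto
      moreover have "(\<Sum>x\<in>insert x J. c x * f x) = c x * f x + (\<Sum>x\<in>J. c x * f x)"
        using insert.hyps by simp
      ultimately show ?thesis using y(2)[OF f] by linarith
    qed
    moreover have "lincomb 1 y (c x) z \<in> Y" using comb y z c by simp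
    ultimately show ?case by blast
  }
qed

text \<open>The space is cut into the finitely many Borel pieces on which all \<open>f\<close> in \<open>F\<close> lie in prescribed
intervals of length \<open>d\<close>, and \<open>s\<close> moves every point to a representative of its piece.\<close>

lemma finite_range_selection:
  fixes m :: "'a::t2_space measure" and F :: "('a \<Rightarrow> real) set"
  assumes sets: "sets m = sets borel" and F: "finite F" "F \<subseteq> C0_nonneg" and "0 < d"
  obtains s :: "'a \<Rightarrow> 'a" where "finite (range s)" "\<And>y. s -` {y} \<in> sets m"
    "\<And>f x. f \<in> F \<Longrightarrow> \<bar>f x - f (s x)\<bar> \<le> d"
proof -
  \<comment> \<open>\<open>G x\<close> is the name of the piece that contains \<open>x\<close>.\<close>
  define G where "G x = (\<lambda>f\<in>F. \<lfloor>f x / d\<rfloor>)" for x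
  define h where "h g = (SOME y. G y = g)" for g
  let ?s = "\<lambda>x. h (G x)"
  have Gs: "G (?s x) = G x" for x unfolding h_def by (rule someI[of _ x]) simp
  have "G x \<in> F \<rightarrow>\<^sub>E {0..\<lfloor>(\<Sum>f\<in>F. SUP x. f x) / d\<rfloor>}" for x
  proof -
    have "\<lfloor>f x / d\<rfloor> \<in> {0..\<lfloor>(\<Sum>f\<in>F. SUP x. f x) / d\<rfloor>}" if f: "f \<in> F" for f
    proof -
      have *: "0 \<le> f y" "f y \<le> (SUP x. f x)" if "f \<in> F" for f y
        using that F C0_nonneg_le_Sup[of f y] by (auto simp: C0_nonneg_def)
      have "0 \<le> (SUP x. g x)" if "g \<in> F" for g using *[OF that, of x] by linarith
      note pos = this
      have "f x \<le> (SUP x. f x)" using *[OF f] by simp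
      also have "\<dots> \<le> (\<Sum>f\<in>F. SUP x. f x)"
        using f F pos by (intro member_le_sum) auto
      finally show ?thesis
        using *(1)[OF f] \<open>0 < d\<close> by (auto intro!: floor_mono divide_right_mono)
    qed
    then show ?thesis by (auto simp: G_def)
  qed
  then have "range G \<subseteq> F \<rightarrow>\<^sub>E {0..\<lfloor>(\<Sum>f\<in>F. SUP x. f x) / d\<rfloor>}" by blast
  then have fin: "finite (range G)" using F(1) by (meson finite_PiE finite_atLeastAtMost_int finite_subset)
  have level: "G -` {G z} \<in> sets m" for z
  proof -
    have "{x. \<lfloor>f x / d\<rfloor> = \<lfloor>f z / d\<rfloor>} \<in> sets borel" if "f \<in> F" for f
    proof -
      have [measurable]: "f \<in> borel_measurable borel"
        using that F by (auto simp: C0_nonneg_def intro: borel_measurable_continuous_onI)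
      have "{x \<in> space borel. \<lfloor>f x / d\<rfloor> = \<lfloor>f z / d\<rfloor>} \<in> sets borel" by measurable
      then show ?thesis by simp
    qed
    then have "space m \<inter> (\<Inter>f\<in>F. {x. \<lfloor>f x / d\<rfloor> = \<lfloor>f z / d\<rfloor>}) \<in> sets m"
      using F sets by (cases "F = {}") (auto intro!: sets.Int sets.finite_INT)
    moreover have "G x = G z \<longleftrightarrow> (\<forall>f\<in>F. \<lfloor>f x / d\<rfloor> = \<lfloor>f z / d\<rfloor>)" for x
    proof
      assume "G x = G z"
      show "\<forall>f\<in>F. \<lfloor>f x / d\<rfloor> = \<lfloor>f z / d\<rfloor>"
      proof
        fix f assume "f \<in> F"
        then show "\<lfloor>f x / d\<rfloor> = \<lfloor>f z / d\<rfloor>"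
          using fun_cong[OF \<open>G x = G z\<close>, of f] by (simp add: G_def)
      qed
    qed (auto simp: G_def)
    then have "G -` {G z} = space m \<inter> (\<Inter>f\<in>F. {x. \<lfloor>f x / d\<rfloor> = \<lfloor>f z / d\<rfloor>})"
      using sets_eq_imp_space_eq[OF sets] by auto
    ultimately show ?thesis by simp
  qed
  show ?thesis
  proof
    show "finite (range ?s)" using finite_imageI[OF fin, of h] by (simp add: image_image)
    fix y
    have "?s -` {y} = (\<Union>g\<in>{g \<in> range G. h g = y}. G -` {g})" by auto
    also have "\<dots> \<in> sets m" using fin level by (intro sets.finite_UN) auto
    finally show "?s -` {y} \<in> sets m" .
  next
    fix f x assume f: "f \<in> F"
    have "\<lfloor>f x / d\<rfloor> = \<lfloor>f (?s x) / d\<rfloor>" 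
      using fun_cong[OF Gs[of x], of f] f by (simp add: G_def)
    then have "\<bar>f x / d - f (?s x) / d\<bar> < 1" by linarith
    then show "\<bar>f x - f (?s x)\<bar> \<le> d" using \<open>0 < d\<close>
      by (simp add: field_simps abs_if split: if_splits)
  qed
qed

text \<open>Replacing \<open>f\<close> by \<open>f \<circ> s\<close>, with \<open>s\<close> of finite range and \<open>f \<circ> s\<close> uniformly close to \<open>f\<close>, turns
the integral of \<open>f\<close> against \<open>m\<close> into a finite sum of values of \<open>f\<close>, that is, into an integral
against a combination of point masses.\<close>

lemma dense_in_FBM_if_dense_in_point_masses:
  fixes Y :: "('a::t2_space set \<Rightarrow> ennreal) set"
  assumes Y: "Y \<subseteq> DTM"
    and comb: "\<And>y z a b. y \<in> Y \<Longrightarrow> z \<in> Y \<Longrightarrow> 0 < a \<Longrightarrow> 0 \<le> b \<Longrightarrow> lincomb a y b z \<in> Y"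
    and dense: "dense_in Y (range point_mass)"
  shows "dense_in Y FBM"
  unfolding dense_in_def
proof
  fix \<mu> :: "'a set \<Rightarrow> ennreal" assume FBM: "\<mu> \<in> FBM"
  then obtain m where \<mu>: "\<mu> = restrict (emeasure m) open_closed_sets"
    and fin: "finite_measure m" and reg: "regular_borel_measure m" by (auto simp: FBM_def)
  interpret finite_measure m by fact
  have sets: "sets m = sets borel" using reg by (simp add: regular_borel_measure_def)
  have sp: "space m = UNIV" using sets_eq_imp_space_eq[OF sets] by simp
  show "\<mu> \<in> weak_topology closure_of Y"
    unfolding in_weak_closure_iff[OF Y]
  proof (intro conjI allI impI)
    show "\<mu> \<in> DTM" using FBM FBM_subset_TM TM_subset_DTM by auto
    fix F :: "('a \<Rightarrow> real) set" and e :: real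
    assume F: "finite F" "F \<subseteq> C0_nonneg" and e: "0 < e"
    let ?M = "measure m UNIV"
    define d where "d = e / 2 / (?M + 1)"
    have M: "0 \<le> ?M" by simp
    have "0 < ?M + 1" using M by linarith
    then have d: "0 < d" unfolding d_def using e by (intro divide_pos_pos) auto
    have "d * ?M \<le> d * (?M + 1)" using d by simp
    also have "\<dots> = e/2" using \<open>0 < ?M + 1\<close> unfolding d_def by (intro nonzero_eq_divide_eq[THEN iffD1]) auto
    finally have dM: "d * ?M \<le> e/2" .
    obtain s :: "'a \<Rightarrow> 'a" where s: "finite (range s)" "\<And>y. s -` {y} \<in> sets m"
      "\<And>f x. f \<in> F \<Longrightarrow> \<bar>f x - f (s x)\<bar> \<le> d"
      using finite_range_selection[OF sets F d] by metis
    define c where "c y = measure m (s -` {y})" for y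
    have close: "\<bar>(\<Sum>y\<in>range s. c y * f y) - dtm_integral \<mu> f\<bar> \<le> e/2" if f: "f \<in> F" for f
    proof -
      have fC: "f \<in> C0_nonneg" using f F by auto
      have [measurable]: "f \<in> borel_measurable m"
        by (rule C0_nonneg_measurable[OF fC sets])
      have int: "integrable m f"
        using fC C0_nonneg_le_Sup[OF fC]
        by (intro integrable_const_bound[of _ "SUP x. f x"]) (auto simp: C0_nonneg_def)
      have simple: "f (s x) = (\<Sum>y\<in>range s. f y * indicator (s -` {y}) x)" for x
      proof -
        have "(\<Sum>y\<in>range s. f y * indicator (s -` {y}) x) = (\<Sum>y\<in>range s. if y = s x then f y else 0)"
          by (intro sum.cong) (auto simp: indicator_def)
        also have "\<dots> = f (s x)" using s(1) by (simp add: sum.delta')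
        finally show ?thesis ..
      qed
      have ind: "integrable m (indicator (s -` {y}) :: 'a \<Rightarrow> real)" for y
        using s(2) by (simp add: integrable_indicator_iff less_top[symmetric])
      have int': "integrable m (\<lambda>x. f (s x))"
        unfolding simple using ind by (intro Bochner_Integration.integrable_sum integrable_mult_right) auto
      have "(LINT x|m. f (s x)) = (\<Sum>y\<in>range s. c y * f y)"
        unfolding simple using ind
        by (subst Bochner_Integration.integral_sum) (auto simp: c_def sp mult.commute)
      moreover have "dtm_integral \<mu> f = (LINT x|m. f x)"
        by (rule dtm_integral_eq_lebesgue_integral[OF fin sets _ fC]) (simp add: \<mu>)
      moreover have "\<bar>(LINT x|m. f (s x) - f x)\<bar> \<le> (LINT x|m. d)"
        using int int' s(3)[OF f]
        by (intro order_trans[OF integral_abs_bound] integral_mono) (auto simp: abs_minus_commute)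
      moreover have "(LINT x|m. f (s x) - f x) = (LINT x|m. f (s x)) - (LINT x|m. f x)"
        using int int' by simp
      ultimately show ?thesis using dM by (simp add: sp mult.commute)
    qed
    obtain y where y: "y \<in> Y" "\<And>f. f \<in> F \<Longrightarrow> \<bar>dtm_integral y f - (\<Sum>y\<in>range s. c y * f y)\<bar> < e/2"
      using approximate_combination_of_point_masses[OF Y comb dense F s(1), of c "e/2"] e
      by (auto simp: c_def)
    have "\<bar>dtm_integral y f - dtm_integral \<mu> f\<bar> < e" if "f \<in> F" for f
      using y(2)[OF that] close[OF that] by linarith
    then show "\<exists>\<mu>'\<in>Y. \<forall>f\<in>F. \<bar>dtm_integral \<mu>' f - dtm_integral \<mu> f\<bar> < e"
      using y(1) by blast
  qed
qed

section \<open>Density\<close>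

lemma dense_in_trans: "dense_in Y Z \<Longrightarrow> dense_in Z W \<Longrightarrow> dense_in Y W"
  unfolding dense_in_def by (meson closedin_closure_of closure_of_minimal order_trans)

lemma dense_in_mono: "dense_in Y Z \<Longrightarrow> Y \<subseteq> Y' \<Longrightarrow> Z' \<subseteq> Z \<Longrightarrow> dense_in Y' Z'"
  unfolding dense_in_def by (meson closure_of_mono order_trans)

text \<open>Every element of \<open>W\<close> is a measure plus a proper part; the measure is approximated from \<open>Y\<close> and the
proper part is added to the approximants.\<close>

lemma dense_in_extend_from_FBM:
  assumes Y: "Y \<subseteq> DTM" and dense: "dense_in Y FBM" and W: "W \<subseteq> DTM"
    and add: "\<And>y \<mu> \<nu>. y \<in> Y \<Longrightarrow> \<mu> \<in> FBM \<Longrightarrow> \<nu> \<in> pDTM \<Longrightarrow> lincomb 1 \<mu> 1 \<nu> \<in> W \<Longrightarrow> lincomb 1 y 1 \<nu> \<in> Y"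
  shows "dense_in Y W"
  unfolding dense_in_def
proof
  fix \<omega> assume \<omega>: "\<omega> \<in> W"
  then obtain \<mu> \<nu> where *: "\<mu> \<in> FBM" "\<nu> \<in> pDTM" "\<omega> = lincomb 1 \<mu> 1 \<nu>"
    using DTM_decomposition W by blast
  have "\<mu> \<in> weak_topology closure_of Y" using dense * by (auto simp: dense_in_def)
  then show "\<omega> \<in> weak_topology closure_of Y"
    unfolding *(3) using * \<omega> add by (intro closure_add[OF Y]) (auto simp: pDTM_def)
qed

lemma lincomb_not_TM:
  assumes "\<mu> \<in> DTM - TM" "\<nu> \<in> DTM" "0 < a"
  shows "lincomb a \<mu> b \<nu> \<in> DTM - TM"
  using assms lincomb_TM_imp_right_TM[of b \<nu> a \<mu>] lincomb_commute[of a \<mu> b \<nu>]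
  by (auto simp: lincomb_DTM)

text \<open>A single \<open>\<kappa>\<close> that is not a topological measure suffices: \<open>\<mu> + \<eta> \<kappa>\<close> is never a topological measure for
\<open>\<eta> > 0\<close> and tends to \<open>\<mu>\<close> as \<open>\<eta>\<close> tends to zero.\<close>

lemma non_TM_dense_in_DTM:
  assumes "(DTM - TM :: ('a::t2_space set \<Rightarrow> ennreal) set) \<noteq> {}"
  shows "dense_in (DTM - TM) (DTM :: ('a set \<Rightarrow> ennreal) set)"
  unfolding dense_in_def
proof
  obtain \<kappa> :: "'a set \<Rightarrow> ennreal" where \<kappa>: "\<kappa> \<in> DTM - TM" using assms by blast
  fix \<mu> :: "'a set \<Rightarrow> ennreal" assume \<mu>: "\<mu> \<in> DTM"
  have "lincomb 1 \<mu> \<eta> \<kappa> \<in> DTM - TM" if "0 < \<eta>" for \<eta>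
    using lincomb_not_TM[OF \<kappa> \<mu> that, of 1] lincomb_commute[of 1 \<mu> \<eta> \<kappa>] by simp
  then show "\<mu> \<in> weak_topology closure_of (DTM - TM)"
    using \<mu> \<kappa> by (intro closure_perturb[of _ \<mu> \<kappa>]) auto
qed

theorem theorem46:
  assumes "locally_compact_space (euclidean :: 'a::t2_space topology)"
  shows
    "(let a = dense_in
                {\<nu> :: 'a set \<Rightarrow> ennreal. deficient_topological_measure \<nu> \<and> simple_set_function \<nu> \<and>
                   proper_set_function \<nu> \<and> \<not> topological_measure \<nu>}
                (range point_mass);
          b = dense_in (pDTM - TM :: ('a set \<Rightarrow> ennreal) set) FBM;
          c = dense_in (pDTM - TM :: ('a set \<Rightarrow> ennreal) set) (DTM - TM);
          d = dense_in (pDTM :: ('a set \<Rightarrow> ennreal) set) DTM;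
          e = dense_in (pDTM :: ('a set \<Rightarrow> ennreal) set) FBM
      in (a \<longrightarrow> b) \<and>
         (b \<longrightarrow> c) \<and>
         ((DTM - TM :: ('a set \<Rightarrow> ennreal) set) \<noteq> {} \<longrightarrow> (c \<longrightarrow> b) \<and> (c \<longrightarrow> d)) \<and>
         (d \<longleftrightarrow> e)) \<and>
     (let a' = dense_in
                 {\<mu> :: 'a set \<Rightarrow> ennreal. \<mu> \<in> TM \<and> simple_set_function \<mu> \<and> proper_set_function \<mu>}
                 (range point_mass);
          b' = dense_in (pTM :: ('a set \<Rightarrow> ennreal) set) FBM;
          c' = dense_in (pTM :: ('a set \<Rightarrow> ennreal) set) TM;
          d' = dense_in (pDTM :: ('a set \<Rightarrow> ennreal) set) DTM
      in (a' \<longrightarrow> b') \<and>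
         (b' \<longleftrightarrow> c') \<and>
         (c' \<longrightarrow> d'))"
proof -
  let ?S = "{\<nu> :: 'a set \<Rightarrow> ennreal. deficient_topological_measure \<nu> \<and> simple_set_function \<nu> \<and>
               proper_set_function \<nu> \<and> \<not> topological_measure \<nu>}"
  let ?S' = "{\<mu> :: 'a set \<Rightarrow> ennreal. \<mu> \<in> TM \<and> simple_set_function \<mu> \<and> proper_set_function \<mu>}"
  let ?D = "DTM :: ('a set \<Rightarrow> ennreal) set"
  let ?T = "TM :: ('a set \<Rightarrow> ennreal) set"
  let ?M = "FBM :: ('a set \<Rightarrow> ennreal) set"
  let ?pD = "pDTM :: ('a set \<Rightarrow> ennreal) set"
  let ?pT = "pTM :: ('a set \<Rightarrow> ennreal) set"
  have MD: "?M \<subseteq> ?D" and MT: "?M \<subseteq> ?T" and TD: "?T \<subseteq> ?D"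
    using FBM_subset_TM TM_subset_DTM by auto
  have pD: "?pD \<subseteq> ?D" by (auto simp: pDTM_def)
  have pT: "?pT = ?pD \<inter> ?T" using TD by (auto simp: pTM_def pDTM_def)
  have simple_finite: "\<nu> UNIV < \<infinity>" if "simple_set_function \<nu>" for \<nu> :: "'a set \<Rightarrow> ennreal"
    using that by (auto simp: simple_set_function_def dest!: bspec[of _ _ UNIV])
  have non_TM: "lincomb a y b z \<in> ?pD - ?T" if "y \<in> ?pD - ?T" "z \<in> ?pD" "0 < a" for y z a b
    using that lincomb_not_TM[of y z a b] lincomb_pDTM[of y z a b] pD by auto
  have pT_comb: "lincomb a y b z \<in> ?pT" if "y \<in> ?pT" "z \<in> ?pT" for y z a b
    using that lincomb_pDTM[of y z a b] lincomb_TM[of y z a b] unfolding pT by blast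
  have ab: "dense_in (?pD - ?T) ?M" if "dense_in ?S (range point_mass)"
  proof (rule dense_in_FBM_if_dense_in_point_masses)
    have "?S \<subseteq> ?pD - ?T" using simple_finite by (auto simp: pDTM_def DTM_def TM_def)
    then show "dense_in (?pD - ?T) (range point_mass)" using that by (auto intro: dense_in_mono)
  qed (use pD non_TM in auto)
  have b_dense: "dense_in (?pD - ?T) ?D" if "dense_in (?pD - ?T) ?M"
    by (rule dense_in_extend_from_FBM[OF _ that subset_refl]) (use pD non_TM in auto)
  have c_dense: "dense_in (?pD - ?T) ?D" if "dense_in (?pD - ?T) (?D - ?T)" "?D - ?T \<noteq> {}"
    using that non_TM_dense_in_DTM by (blast intro: dense_in_trans)
  have ed: "dense_in ?pD ?D" if "dense_in ?pD ?M"
    by (rule dense_in_extend_from_FBM[OF pD that subset_refl]) (rule lincomb_pDTM)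
  have a'b': "dense_in ?pT ?M" if "dense_in ?S' (range point_mass)"
  proof (rule dense_in_FBM_if_dense_in_point_masses)
    have "?S' \<subseteq> ?pT" by (auto simp: pTM_def)
    then show "dense_in ?pT (range point_mass)" using that by (auto intro: dense_in_mono)
  qed (use pD pT pT_comb in auto)
  have b'c': "dense_in ?pT ?T" if "dense_in ?pT ?M"
  proof (rule dense_in_extend_from_FBM[OF _ that TD])
    fix y \<mu> \<nu> :: "'a set \<Rightarrow> ennreal"
    assume *: "y \<in> ?pT" "\<mu> \<in> ?M" "\<nu> \<in> ?pD" "lincomb 1 \<mu> 1 \<nu> \<in> ?T"
    then have "\<nu> \<in> ?T" using MD pD by (intro lincomb_TM_imp_right_TM[OF *(4)]) auto
    then show "lincomb 1 y 1 \<nu> \<in> ?pT" using * pT by (auto intro: lincomb_TM lincomb_pDTM)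
  qed (use pD pT in auto)
  have c'b': "dense_in ?pT ?M" if "dense_in ?pT ?T" using that MT by (auto intro: dense_in_mono)
  have c'd': "dense_in ?pD ?D" if "dense_in ?pT ?T"
    using c'b'[OF that] pT by (intro ed) (auto intro: dense_in_mono)
  have sub: "dense_in Y ?D \<Longrightarrow> dense_in Y ?M" "dense_in Y ?D \<Longrightarrow> dense_in Y (?D - ?T)"
    "dense_in (?pD - ?T) ?D \<Longrightarrow> dense_in ?pD ?D" for Y
    using MD by (auto intro: dense_in_mono)
  show ?thesis
    unfolding Let_def
    using ab b_dense c_dense ed a'b' b'c' c'b' c'd' sub by blast
qed

end
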